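(* Let $k\in\mathbb N$, $k>1$, and let $\beta(x,y):=(\beta_0,\beta_1,\ldots,\beta_{2k-3},y,x,\beta_{2k})$ be a sequence, where each $\beta_i$ is a real number, $\beta_0>0$ and $x,y$ are variables ($y$ in the position of index $2k-2$, $x$ in the position of index $2k-1$). Let $\widehat\beta:=(\beta_0,\ldots,\beta_{2k-6})$ and $\widetilde\beta:=(\beta_0,\ldots,\beta_{2k-4})$ be subsequences of $\beta(x,y)$, let $$u:=(\beta_k\ \cdots\ \beta_{2k-3}),\quad s:=(\beta_{k-1}\ \cdots\ \beta_{2k-3}),\quad w:=(\beta_{k-2}\ \cdots\ \beta_{2k-5})$$ be row vectors and let $$\widetilde A:=\begin{pmatrix} A_{\widehat\beta} & u^T \\ u & \beta_{2k} \end{pmatrix}$$ (the objects $\widehat\beta,u,w,\widetilde A$ are only used when $k>2$). Then the following statements are equivalent: (1) There exist $x_0,y_0\in\mathbb R$ and a representing measure for $\beta(x_0,y_0)$ supported on $\mathbb R$. (2) There exist $x_0,y_0\in\mathbb R$ and a $(\operatorname{rank}\widetilde\beta)$-atomic or $(\operatorname{rank}\widetilde\beta+1)$-atomic representing measure for $\beta(x_0,y_0)$. (3) $A_{\beta(x,y)}$ is partially positive semidefinite and one of the following conditions holds: (a) $k=2$ and $\frac{\beta_1^2}{\beta_0}\le\sqrt{\beta_0\beta_4}$. (b) $k>2$, the inequality $$sA_{\widetilde\beta}^+s^T\le uA_{\widehat\beta}^+w^T+\sqrt{(A_{\widetilde\beta}/A_{\widehat\beta})(\widetilde A/A_{\widehat\beta})}$$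 holds and one of the following conditions is true: (i) $A_{\widetilde\beta}\succ0$. (ii) $\operatorname{rank}A_{\widehat\beta}=\operatorname{rank}A_{\widetilde\beta}=\operatorname{rank}\begin{pmatrix}A_{\widetilde\beta}&s^T\end{pmatrix}=\operatorname{rank}\widetilde A$. Moreover, if a representing measure exists (i.e. if (1) holds), then: - If $k=2$, then there is a $1$-atomic measure if $\frac{\beta_1^2}{\beta_0}=\sqrt{\beta_0\beta_4}$; otherwise there is a $2$-atomic measure. - If $k>2$, there exists a $(\operatorname{rank}\widetilde\beta)$-atomic measure if and only if one of the equalities $$sA_{\widetilde\beta}^+s^T=uA_{\widehat\beta}^+w^T-\sqrt{(A_{\widetilde\beta}/A_{\widehat\beta})(\widetilde A/A_{\widehat\beta})}\quad\text{or}\quad sA_{\widetilde\beta}^+s^T=uA_{\widehat\beta}^+w^T+\sqrt{(A_{\widetilde\beta}/A_{\widehat\beta})(\widetilde A/A_{\widehat\beta})}$$ holds. Here "measure" in the last part means a representing measure for $\beta(x_0,y_0)$ for some $x_0,y_0\in\mathbb R$.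
   Context: $\mathbb N$ is the set of positive integers. For a sequence $\gamma=(\gamma_0,\ldots,\gamma_{2m})$ of odd length, $A_\gamma:=(\gamma_{i+j})_{i,j=0}^m$ is the corresponding $(m+1)\times(m+1)$ Hankel matrix (a subsequence is re-indexed from $0$). With columns $\mathbf v_0,\ldots,\mathbf v_m$ of $A_\gamma$, the rank of the sequence is $\operatorname{rank}\gamma:=m+1$ if $A_\gamma$ is nonsingular and $\operatorname{rank}\gamma:=\min\{i:\mathbf v_i\in\operatorname{span}\{\mathbf v_0,\ldots,\mathbf v_{i-1}\}\}$ if $A_\gamma$ is singular (the span of the empty set is $\{0\}$). This is distinguished from the matrix rank $\operatorname{rank}A_\gamma$. For a matrix $A$, $A^+$ is its Moore–Penrose inverse. For a block matrix $M=\begin{pmatrix} A & B \\ C & D \end{pmatrix}$ the generalized Schur complement of $A$ in $M$ is $M/A:=D-CA^+B$ and that of $D$ is $M/D:=A-BD^+C$. In $A_{\widetilde\beta}/A_{\widehat\beta}$ and $\widetilde A/A_{\widehat\beta}$, $A_{\widehat\beta}$ is the upper left block and the complement is a real number. A representing measure (supported on $\mathbb R$) for a real sequence $(\beta_0,\ldots,\beta_{2k})$ is a positive Borel measure $\mu$ on $\mathbb R$ with $\beta_i=\int_{\mathbb R}t^i\,d\mu(t)$ for $i=0,\ldots,2k$. A measure is $m$-atomic if it is a sum of $m$ point masses with positive weights at distinct points. A partial symmetric matrix (some symmetric pairs of entries unspecified, here those containing variables) is partially positive semidefinite if every principal submatrix all of whose entries are specified is positive semidefinite. $A\succ0$ means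 positive definite. *)

theory Defs
  imports
    "HOL-Probability.Probability"
    "Jordan_Normal_Form.DL_Rank"
    "Jordan_Normal_Form.DL_Submatrix"
begin

(* HOL-Analysis also owns the infix $ and the bullet; here they are the ones of
   Jordan_Normal_Form, whose matrices have term-level dimensions. *)
unbundle no vec_syntax
unbundle no inner_syntax

section \<open>Matrices\<close>

abbreviation mat_rank :: "real mat \<Rightarrow> nat" where
  "mat_rank A \<equiv> vec_space.rank (dim_row A) A"

definition psd_mat :: "real mat \<Rightarrow> bool" where
  "psd_mat A \<longleftrightarrow> square_mat A \<and> A\<^sup>T = A \<and>
     (\<forall>v \<in> carrier_vec (dim_row A). 0 \<le> v \<bullet> (A *\<^sub>v v))"

definition pd_mat :: "real mat \<Rightarrow> bool" where
  "pd_mat A \<longleftrightarrow> square_mat A \<and> A\<^sup>T = A \<and>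
     (\<forall>v \<in> carrier_vec (dim_row A). v \<noteq> 0\<^sub>v (dim_row A) \<longrightarrow> 0 < v \<bullet> (A *\<^sub>v v))"

definition is_moore_penrose :: "real mat \<Rightarrow> real mat \<Rightarrow> bool" where
  "is_moore_penrose A X \<longleftrightarrow> X \<in> carrier_mat (dim_col A) (dim_row A) \<and>
     A * X * A = A \<and> X * A * X = X \<and> (A * X)\<^sup>T = A * X \<and> (X * A)\<^sup>T = X * A"

lemma is_moore_penrose_unique:
  assumes X: "is_moore_penrose A X" and Y: "is_moore_penrose A Y"
  shows "X = Y"
proof -
  define m n where "m = dim_row A" and "n = dim_col A"
  have [simp]: "A \<in> carrier_mat m n" "X \<in> carrier_mat n m" "Y \<in> carrier_mat n m"
    using X Y by (auto simp: m_def n_def is_moore_penrose_def)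
  have [simp]: "A * X \<in> carrier_mat m m" "A * Y \<in> carrier_mat m m"
    "X * A \<in> carrier_mat n n" "Y * A \<in> carrier_mat n n"
    by (auto intro: mult_carrier_mat[of _ _ n] mult_carrier_mat[of _ _ m])
  have AX: "A * X = A * Y"
  proof -
    have "A * X = (A * X)\<^sup>T" using X by (simp add: is_moore_penrose_def)
    also have "\<dots> = ((A * Y * A) * X)\<^sup>T" using Y by (simp add: is_moore_penrose_def)
    also have "\<dots> = ((A * Y) * (A * X))\<^sup>T" by (subst assoc_mult_mat[of _ m m _ n _ m]) auto
    also have "\<dots> = (A * X)\<^sup>T * (A * Y)\<^sup>T" by (rule transpose_mult[of _ m m _ m]) auto
    also have "\<dots> = (A * X) * (A * Y)" using X Y by (simp add: is_moore_penrose_def)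
    also have "\<dots> = (A * X * A) * Y" by (subst assoc_mult_mat[of _ m m _ n _ m]) auto
    also have "\<dots> = A * Y" using X by (simp add: is_moore_penrose_def)
    finally show ?thesis .
  qed
  have XA: "X * A = Y * A"
  proof -
    have "X * A = (X * A)\<^sup>T" using X by (simp add: is_moore_penrose_def)
    also have "\<dots> = (X * (A * Y * A))\<^sup>T" using Y by (simp add: is_moore_penrose_def)
    also have "A * Y * A = A * (Y * A)" by (rule assoc_mult_mat[of _ m n _ m _ n]) auto
    also have "X * (A * (Y * A)) = (X * A) * (Y * A)"
      by (subst assoc_mult_mat[of _ n m _ n _ n]) auto
    also have "\<dots>\<^sup>T = (Y * A)\<^sup>T * (X * A)\<^sup>T" by (rule transpose_mult[of _ n n _ n]) auto
    also have "\<dots> = (Y * A) * (X * A)" using X Y by (simp add: is_moore_penrose_def)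
    also have "\<dots> = Y * (A * (X * A))" by (rule assoc_mult_mat[of _ n m _ n _ n]) auto
    also have "A * (X * A) = A * X * A" by (rule assoc_mult_mat[of _ m n _ m _ n, symmetric]) auto
    also have "\<dots> = A" using X by (simp add: is_moore_penrose_def)
    finally show ?thesis .
  qed
  have "X = X * A * X" using X by (simp add: is_moore_penrose_def)
  also have "\<dots> = Y * A * X" by (simp add: XA)
  also have "\<dots> = Y * (A * X)" by (rule assoc_mult_mat[of _ n m _ n _ m]) auto
  also have "\<dots> = Y * A * Y" unfolding AX by (rule assoc_mult_mat[of _ n m _ n _ m, symmetric]) auto
  also have "\<dots> = Y" using Y by (simp add: is_moore_penrose_def)
  finally show ?thesis .
qed

definition pinv :: "real mat \<Rightarrow> real mat" where
  "pinv A = (THE X. is_moore_penrose A X)"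

text \<open>Generalized Schur complement \<open>M/A\<close>, where \<open>A\<close> is the upper left \<open>r \<times> r\<close> block of \<open>M\<close>.\<close>

definition schur_complement :: "real mat \<Rightarrow> nat \<Rightarrow> real mat" where
  "schur_complement M r = (case split_block M r r of (A, B, C, D) \<Rightarrow> D - C * pinv A * B)"

text \<open>A partial matrix has entries in \<^typ>\<open>real option\<close>; \<^const>\<open>None\<close> marks an unspecified entry.\<close>

definition partially_psd :: "real option mat \<Rightarrow> bool" where
  "partially_psd P \<longleftrightarrow> square_mat P \<and>
     (\<forall>I \<subseteq> {0..<dim_row P}. (\<forall>i\<in>I. \<forall>j\<in>I. P $$ (i, j) \<noteq> None) \<longrightarrow>
        psd_mat (map_mat the (submatrix P I I)))"

section \<open>Sequences\<close>

text \<open>A finite sequence \<open>\<gamma>\<^sub>0, \<dots>, \<gamma>\<^sub>n\<close> is a function on \<^typ>\<open>nat\<close> together with its last index \<open>n\<close>;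
  values beyond \<open>n\<close> are never used. Initial subsequences differ in the last index only.\<close>

definition hankel :: "nat \<Rightarrow> (nat \<Rightarrow> 'a) \<Rightarrow> 'a mat" where
  "hankel m \<gamma> = mat (m + 1) (m + 1) (\<lambda>(i, j). \<gamma> (i + j))"

text \<open>The rank of the sequence \<open>\<gamma>\<^sub>0, \<dots>, \<gamma>\<^bsub>2m\<^esub>\<close>, as opposed to the rank of its Hankel matrix.\<close>

definition seq_rank :: "nat \<Rightarrow> (nat \<Rightarrow> real) \<Rightarrow> nat" where
  "seq_rank m \<gamma> =
     (if invertible_mat (hankel m \<gamma>) then m + 1
      else LEAST i. i \<le> m \<and> col (hankel m \<gamma>) i \<in>
             LinearCombinations.module.span class_ring (module_vec TYPE(real) (m + 1))
               (col (hankel m \<gamma>) ` {..<i}))"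

text \<open>The sequence \<open>\<beta>(x, y) = (\<beta>\<^sub>0, \<dots>, \<beta>\<^bsub>2k-3\<^esub>, y, x, \<beta>\<^bsub>2k\<^esub>)\<close> with values for the variables,
  and with both left unspecified. In either case \<open>\<beta> (2k-2)\<close> and \<open>\<beta> (2k-1)\<close> are ignored.\<close>

definition completion :: "nat \<Rightarrow> (nat \<Rightarrow> real) \<Rightarrow> real \<Rightarrow> real \<Rightarrow> nat \<Rightarrow> real" where
  "completion k \<beta> x y = \<beta>(2 * k - 2 := y, 2 * k - 1 := x)"

definition partial_seq :: "nat \<Rightarrow> (nat \<Rightarrow> real) \<Rightarrow> nat \<Rightarrow> real option" where
  "partial_seq k \<beta> = (\<lambda>i. Some (\<beta> i))(2 * k - 2 := None, 2 * k - 1 := None)"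

section \<open>Representing measures\<close>

definition representing_measure :: "nat \<Rightarrow> (nat \<Rightarrow> real) \<Rightarrow> real measure \<Rightarrow> bool" where
  "representing_measure n \<gamma> \<mu> \<longleftrightarrow> sets \<mu> = sets borel \<and>
     (\<forall>i\<le>n. integrable \<mu> (\<lambda>t. t ^ i) \<and> (\<integral>t. t ^ i \<partial>\<mu>) = \<gamma> i)"

definition atomic_measure :: "nat \<Rightarrow> real measure \<Rightarrow> bool" where
  "atomic_measure m \<mu> \<longleftrightarrow> sets \<mu> = sets borel \<and>
     (\<exists>T c. finite T \<and> card T = m \<and> (\<forall>t\<in>T. 0 < c t) \<and>
        (\<forall>B\<in>sets borel. emeasure \<mu> B = (\<Sum>t\<in>T. ennreal (c t) * emeasure (return borel t) B)))"

definition has_representing_measure :: "nat \<Rightarrow> (nat \<Rightarrow> real) \<Rightarrow> bool" where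
  "has_representing_measure k \<beta> \<longleftrightarrow>
     (\<exists>x y \<mu>. representing_measure (2 * k) (completion k \<beta> x y) \<mu>)"

definition has_atomic_representing_measure :: "nat \<Rightarrow> nat \<Rightarrow> (nat \<Rightarrow> real) \<Rightarrow> bool" where
  "has_atomic_representing_measure m k \<beta> \<longleftrightarrow>
     (\<exists>x y \<mu>. representing_measure (2 * k) (completion k \<beta> x y) \<mu> \<and> atomic_measure m \<mu>)"

end

theory Submission
  imports Defs "Jordan_Normal_Form.Char_Poly"
begin

text \<open>
  Let \<open>\<Lambda>\<close> be the functional \<open>t\<^sup>i \<mapsto> \<beta>\<^sub>i\<close>. Project the monomials of degree \<open>k - 2\<close> and \<open>k\<close> away from
  the polynomials of degree at most \<open>k - 3\<close>, and that of degree \<open>k - 1\<close> away from those of degree at most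
  \<open>k - 2\<close>; the residues \<open>W\<close>, \<open>U\<close>, \<open>S\<close> satisfy \<open>\<Lambda>(W U) = y - R\<close> and \<open>\<Lambda>(S\<^sup>2) = y - L\<close>, and \<open>\<Lambda>(W\<^sup>2)\<close>,
  \<open>\<Lambda>(U\<^sup>2)\<close> are the two Schur complements. Hence positivity and the Cauchy-Schwarz inequality force
  \<open>L \<le> y\<close> and \<open>R - D \<le> y \<le> R + D\<close>. Conversely, at an end point \<open>y = R \<plusminus> D\<close> with \<open>y \<ge> L\<close> some combination
  \<open>Q = U - \<kappa> W\<close> becomes null once \<open>x\<close> is chosen properly, so the completed Hankel matrix is positive
  semidefinite with its last column in the span of the others, and Gauss quadrature at the roots of the
  minimal null polynomial gives a measure. That polynomial is \<open>S\<close> if \<open>y = L\<close> and \<open>Q\<close> otherwise when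
  the Hankel matrix of \<open>\<beta>\<^sub>0, \<dots>, \<beta>\<^bsub>2k-4\<^esub>\<close> is positive definite; when it is singular, every measure lives on the
  roots of a polynomial of degree at most \<open>k - 2\<close>, which makes both Schur complements vanish.
\<close>

section \<open>Riesz functionals and Hankel matrices\<close>

hide_const (open) Module.smult

text \<open>The gap dictates the degrees of the projections: \<Lambda> is known on t^(k-1) times
  degree at most k - 2 and on t^k times degree at most k - 3, while t^k times t^(k-2) or t^(k-1)
  hits y or x. Of the unknowns only y enters the inequalities; x occurs in one linear equation,
  which can always be solved. Positive semidefiniteness alone does not produce a measure, since mass
  may escape to infinity and contribute to the top moment only. Hence sufficiency is proved at an
  end point of [R - D, R + D], where a null polynomial of full degree k is available; L \<le> R + D
  says precisely that the upper end point respects L \<le> y. The rank equalities encode that the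
  normal equations defining W, U, S are solvable and that both Schur complements vanish. In the
  other direction, a measure with at most k - 1 atoms forces \<Lambda>(S^2) = 0 and \<Lambda>(Q^2) =
  0, that is, y = L at an end point; this is the source of the equalities L = R - D and L = R +
  D.\<close>

definition riesz :: "(nat \<Rightarrow> real) \<Rightarrow> real poly \<Rightarrow> real" where
  "riesz \<gamma> p = (\<Sum>i\<le>degree p. coeff p i * \<gamma> i)"

lemma riesz_eq_sum:
  assumes "degree p \<le> n"
  shows "riesz \<gamma> p = (\<Sum>i\<le>n. coeff p i * \<gamma> i)"
  unfolding riesz_def using assms
  by (intro sum.mono_neutral_left) (auto simp: coeff_eq_0)

lemma riesz_0 [simp]: "riesz \<gamma> 0 = 0"
  by (simp add: riesz_def)

lemma riesz_add: "riesz \<gamma> (p + q) = riesz \<gamma> p + riesz \<gamma> q"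
proof -
  let ?n = "max (degree p) (degree q)"
  have "degree (p + q) \<le> ?n" by (rule degree_add_le_max)
  then show ?thesis
    by (simp add: riesz_eq_sum[of _ ?n] sum.distrib distrib_right)
qed

lemma riesz_smult: "riesz \<gamma> (smult c p) = c * riesz \<gamma> p"
  by (simp add: riesz_eq_sum[of _ "degree p"] degree_smult_le sum_distrib_left mult_ac)

lemma riesz_minus: "riesz \<gamma> (- p) = - riesz \<gamma> p"
  using riesz_smult[of \<gamma> "-1" p] by simp

lemma riesz_diff: "riesz \<gamma> (p - q) = riesz \<gamma> p - riesz \<gamma> q"
  using riesz_add[of \<gamma> p "- q"] by (simp add: riesz_minus)

lemma riesz_sum: "riesz \<gamma> (\<Sum>i\<in>I. f i) = (\<Sum>i\<in>I. riesz \<gamma> (f i))"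
  by (induction I rule: infinite_finite_induct) (auto simp: riesz_add)

lemma riesz_monom [simp]: "riesz \<gamma> (monom c n) = c * \<gamma> n"
proof (cases "c = 0")
  case False
  then show ?thesis
    by (simp add: riesz_def degree_monom_eq if_distrib[of "\<lambda>x. x * _"] cong: if_cong)
qed simp

lemmas riesz_linear = riesz_add riesz_diff riesz_minus riesz_smult riesz_sum

text \<open>Used to trade the functional of a completion for that of \<open>\<beta>\<close> on
  squares of polynomials of degree at most k - 2, which do not reach the gap.\<close>

lemma riesz_cong:
  assumes "\<And>i. i \<le> degree p \<Longrightarrow> \<gamma> i = \<delta> i"
  shows "riesz \<gamma> p = riesz \<delta> p"
  using assms by (simp add: riesz_def)

lemma riesz_mult_eq_0:
  assumes "\<And>j. j \<le> m \<Longrightarrow> riesz \<gamma> (p * monom 1 j) = 0" "degree q \<le> m"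
  shows "riesz \<gamma> (p * q) = 0"
proof -
  have "p * q = (\<Sum>j\<le>degree q. smult (coeff q j) (p * monom 1 j))"
    using arg_cong[OF poly_as_sum_of_monoms[of q], of "(*) p"]
    by (simp add: sum_distrib_left smult_monom flip: mult_smult_right)
  then show ?thesis
    using assms by (simp add: riesz_linear)
qed

text \<open>For n = 0 the difference is 0, whose degree is again 0, so strictness requires 0 <
  n.\<close>

lemma degree_minus_lead_lt:
  fixes q U :: "real poly"
  assumes "degree q \<le> n" "degree U = n" "coeff U n = 1" "0 < n"
  shows "degree (q - smult (coeff q n) U) < n"
proof -
  have "degree (q - smult (coeff q n) U) \<le> n"
    using assms by (meson degree_diff_le degree_smult_le le_trans order_refl)
  moreover have "coeff (q - smult (coeff q n) U) n = 0"
    using assms by simp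
  ultimately show ?thesis
    using assms(4) by (metis degree_0 eq_zero_or_degree_less)
qed

lemma degree_diff_monic_le:
  fixes q U :: "real poly"
  assumes "degree q \<le> Suc n" "degree U = Suc n" "coeff U (Suc n) = 1"
  shows "degree (q - smult (coeff q (Suc n)) U) \<le> n"
  using degree_minus_lead_lt[of q "Suc n" U] assms by simp

section \<open>Hankel matrices as Gram matrices of the monomials\<close>

definition vpoly :: "real vec \<Rightarrow> real poly" where
  "vpoly v = (\<Sum>i<dim_vec v. monom (v $ i) i)"

lemma coeff_vpoly: "coeff (vpoly v) i = (if i < dim_vec v then v $ i else 0)"
  by (simp add: vpoly_def coeff_sum)

lemma degree_vpoly: "v \<in> carrier_vec (Suc n) \<Longrightarrow> degree (vpoly v) \<le> n"
  by (rule degree_le) (auto simp: coeff_vpoly)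

lemma vpoly_vec_coeff: "degree p \<le> n \<Longrightarrow> vpoly (vec (Suc n) (coeff p)) = p"
  by (rule poly_eqI) (auto simp: coeff_vpoly coeff_eq_0)

lemma riesz_vpoly_mult:
  assumes "v \<in> carrier_vec n"
  shows "riesz \<gamma> (vpoly v * monom 1 j) = (\<Sum>i<n. v $ i * \<gamma> (i + j))"
  using assms by (auto simp: vpoly_def sum_distrib_right riesz_sum mult_monom)

lemma hankel_carrier [simp]: "hankel m \<gamma> \<in> carrier_mat (Suc m) (Suc m)"
  by (simp add: hankel_def)

lemma hankel_index [simp]: "i \<le> m \<Longrightarrow> j \<le> m \<Longrightarrow> hankel m \<gamma> $$ (i, j) = \<gamma> (i + j)"
  by (simp add: hankel_def)

lemma hankel_dims [simp]: "dim_row (hankel m \<gamma>) = Suc m" "dim_col (hankel m \<gamma>) = Suc m"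
  by (simp_all add: hankel_def)

lemma hankel_sym: "(hankel m \<gamma>)\<^sup>T = hankel m \<gamma>"
  by (rule eq_matI) (auto simp: hankel_def add.commute)

lemma hankel_mult_vec:
  assumes "v \<in> carrier_vec (Suc m)" "j \<le> m"
  shows "(hankel m \<gamma> *\<^sub>v v) $ j = riesz \<gamma> (vpoly v * monom 1 j)"
  using assms by (auto simp: riesz_vpoly_mult scalar_prod_def hankel_def mult.commute add.commute
      atLeast0LessThan intro!: sum.cong)

lemma hankel_quadratic_form:
  assumes "v \<in> carrier_vec (Suc m)" "u \<in> carrier_vec (Suc m)"
  shows "u \<bullet> (hankel m \<gamma> *\<^sub>v v) = riesz \<gamma> (vpoly v * vpoly u)"
proof -
  have "riesz \<gamma> (vpoly v * vpoly u) = (\<Sum>j<Suc m. u $ j * riesz \<gamma> (vpoly v * monom 1 j))"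
  proof -
    have "vpoly v * vpoly u = (\<Sum>j<Suc m. smult (u $ j) (vpoly v * monom 1 j))"
      using assms unfolding vpoly_def[of u]
      by (simp add: sum_distrib_left distrib_left smult_monom flip: mult_smult_right)
    then show ?thesis by (simp add: riesz_linear)
  qed
  also have "\<dots> = u \<bullet> (hankel m \<gamma> *\<^sub>v v)"
    using assms by (simp add: scalar_prod_def atLeast0LessThan hankel_mult_vec[symmetric] del: index_mult_mat_vec)
  finally show ?thesis ..
qed

text \<open>Semidefiniteness is read off polynomials, so that a congruence of the matrix becomes a
  decomposition of a polynomial.\<close>

lemma psd_hankel_iff:
  "psd_mat (hankel m \<gamma>) \<longleftrightarrow> (\<forall>p. degree p \<le> m \<longrightarrow> 0 \<le> riesz \<gamma> (p * p))" (is "_ \<longleftrightarrow> ?R")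
proof
  assume L: "psd_mat (hankel m \<gamma>)"
  show ?R
  proof (intro allI impI)
    fix p :: "real poly" assume "degree p \<le> m"
    then have "vpoly (vec (Suc m) (coeff p)) = p" by (rule vpoly_vec_coeff)
    moreover have "vec (Suc m) (coeff p) \<in> carrier_vec (Suc m)" by simp
    ultimately show "0 \<le> riesz \<gamma> (p * p)"
      using L hankel_quadratic_form[of "vec (Suc m) (coeff p)" m "vec (Suc m) (coeff p)" \<gamma>]
      by (simp add: psd_mat_def) (metis vec_carrier)
  qed
next
  assume ?R
  then show "psd_mat (hankel m \<gamma>)"
    by (auto simp: psd_mat_def hankel_sym hankel_quadratic_form degree_vpoly)
qed

lemma vpoly_eq_0_iff: "vpoly v = 0 \<longleftrightarrow> v = 0\<^sub>v (dim_vec v)"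
proof -
  have "vpoly v = 0 \<longleftrightarrow> (\<forall>i<dim_vec v. v $ i = 0)"
    by (auto simp: poly_eq_iff coeff_vpoly)
  then show ?thesis by (auto simp: vec_eq_iff)
qed

lemma pd_hankel_iff:
  "pd_mat (hankel m \<gamma>) \<longleftrightarrow> (\<forall>p. degree p \<le> m \<longrightarrow> p \<noteq> 0 \<longrightarrow> 0 < riesz \<gamma> (p * p))" (is "_ \<longleftrightarrow> ?R")
proof
  assume L: "pd_mat (hankel m \<gamma>)"
  show ?R
  proof (intro allI impI)
    fix p :: "real poly" assume p: "degree p \<le> m" "p \<noteq> 0"
    then have e: "vpoly (vec (Suc m) (coeff p)) = p" by (auto intro: vpoly_vec_coeff)
    then have "vec (Suc m) (coeff p) \<noteq> 0\<^sub>v (Suc m)"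
      using p vpoly_eq_0_iff[of "vec (Suc m) (coeff p)"] by auto
    then show "0 < riesz \<gamma> (p * p)"
      using L hankel_quadratic_form[of "vec (Suc m) (coeff p)" m "vec (Suc m) (coeff p)" \<gamma>] e
      by (auto simp: pd_mat_def)
  qed
next
  assume ?R
  then show "pd_mat (hankel m \<gamma>)"
    by (auto simp: pd_mat_def hankel_sym hankel_quadratic_form degree_vpoly vpoly_eq_0_iff)
qed

lemma quadratic_nonneg_imp_linear_coeff_0:
  fixes b c :: real
  assumes "\<And>t. 0 \<le> 2 * t * b + t\<^sup>2 * c"
  shows "b = 0"
proof (rule ccontr)
  assume b: "b \<noteq> 0"
  \<comment> \<open>\<open>d\<close> bounds c from above and is positive for every c, so t = - b / d
    is a legal point; the quadratic is at most - b^2 / d there.\<close>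
  define d where "d = \<bar>c\<bar> + 1"
  have d: "d > 0" "c \<le> d" by (auto simp: d_def)
  have "0 \<le> 2 * (- b / d) * b + (- b / d)\<^sup>2 * c" by (rule assms)
  also have "\<dots> \<le> 2 * (- b / d) * b + (- b / d)\<^sup>2 * d"
    using d by (intro add_left_mono mult_left_mono) auto
  also have "\<dots> = - b\<^sup>2 / d"
    using d by (simp add: field_simps power2_eq_square)
  also have "\<dots> < 0" using b d by simp
  finally show False by simp
qed

text \<open>Cauchy-Schwarz with a null factor: \<Lambda>((p + t f)^2) is nonnegative for all t and
  has no constant term, so its linear coefficient vanishes.\<close>

lemma riesz_null:
  assumes psd: "\<And>q. degree q \<le> n \<Longrightarrow> 0 \<le> riesz \<gamma> (q * q)"
    and p: "degree p \<le> n" "riesz \<gamma> (p * p) = 0" and f: "degree f \<le> n"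
  shows "riesz \<gamma> (p * f) = 0"
proof (rule quadratic_nonneg_imp_linear_coeff_0)
  fix t :: real
  have "0 \<le> riesz \<gamma> ((p + smult t f) * (p + smult t f))"
    using p f by (intro psd degree_add_le) (auto intro: order.trans[OF degree_smult_le])
  also have "(p + smult t f) * (p + smult t f)
      = p * p + smult t (p * f) + smult t (p * f) + smult (t * t) (f * f)"
    by (simp add: algebra_simps)
  also have "riesz \<gamma> \<dots> = 2 * t * riesz \<gamma> (p * f) + t\<^sup>2 * riesz \<gamma> (f * f)"
    using p by (simp only: riesz_linear) (simp add: power2_eq_square)
  finally show "0 \<le> 2 * t * riesz \<gamma> (p * f) + t\<^sup>2 * riesz \<gamma> (f * f)" .
qed

section \<open>Gauss quadrature for flat functionals\<close>

text \<open>The excluded factor is (t - a)^2 + b^2: for b \<noteq> 0 it rules out a conjugate pair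
  of nonreal roots, for b = 0 a double real root. Splitting off one real root at a time then counts
  all of them.\<close>

lemma degree_eq_card_real_roots:
  fixes p :: "real poly"
  assumes "p \<noteq> 0" "\<And>a b. \<not> [:a\<^sup>2 + b\<^sup>2, - 2 * a, 1:] dvd p"
  shows "card {x. poly p x = 0} = degree p"
  using assms
proof (induction "degree p" arbitrary: p)
  case 0
  then obtain c where "p = [:c:]" "c \<noteq> 0"
    using degree_eq_zeroE by (metis pCons_0_0)
  then show ?case by simp
next
  case (Suc n)
  define P where "P = map_poly complex_of_real p"
  have "degree P = degree p" unfolding P_def by (rule degree_map_poly) auto
  then have "\<not> constant (poly P)" using Suc.hyps(2) by (simp add: constant_degree)
  then obtain z where z: "poly P z = 0" using fundamental_theorem_of_algebra by blast
  have linear_map_poly: "map_poly complex_of_real [:c, d:] = [:of_real c, of_real d:]" for c d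
    by (simp add: of_real_hom.map_poly_pCons_hom)
  \<comment> \<open>A nonzero real polynomial of degree at most 1 has no nonreal root; this will
    force the remainder of p modulo the real quadratic of z to be 0.\<close>
  have real_part: "poly (map_poly complex_of_real r) z = 0 \<Longrightarrow> r = 0"
    if "degree r < 2" "Im z \<noteq> 0" for r :: "real poly"
  proof -
    assume r: "poly (map_poly complex_of_real r) z = 0"
    have "degree r \<le> 1" using that by simp
    then obtain c d where re: "r = [:c, d:]"
      by (cases r rule: pCons_cases) (metis degree_eq_zeroE degree_pCons_eq degree_0 One_nat_def Suc_le_mono le_zero_eq)
    then have "complex_of_real c + z * complex_of_real d = 0"
      using r unfolding re linear_map_poly by simp
    then have "c = 0 \<and> d = 0"
      using that(2) by (auto simp: complex_eq_iff)
    then show "r = 0" using re by simp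
  qed
  have "Im z = 0"
  proof (rule ccontr)
    assume im: "Im z \<noteq> 0"
    \<comment> \<open>The product of t - z and t minus the conjugate of z.\<close>
    define d where "d = [:(Re z)\<^sup>2 + (Im z)\<^sup>2, - 2 * Re z, 1:]"
    have "poly (map_poly complex_of_real d) z = 0"
      by (simp add: d_def of_real_hom.map_poly_pCons_hom complex_eq_iff power2_eq_square algebra_simps)
    moreover have "map_poly complex_of_real (p mod d) = P mod map_poly complex_of_real d"
      unfolding P_def by (rule of_real_hom.map_poly_mod)
    moreover have "poly P z = poly (P div D) z * poly D z + poly (P mod D) z" for D
      by (metis div_mult_mod_eq poly_add poly_mult)
    ultimately have "poly (map_poly complex_of_real (p mod d)) z = 0"
      using z by (metis add_0 mult_zero_right)
    moreover have "degree (p mod d) < 2"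
      using degree_mod_less[of d p] by (auto simp: d_def)
    ultimately have "p mod d = 0" using real_part im by blast
    then have "d dvd p" by (simp add: dvd_eq_mod_eq_0)
    then show False using Suc.prems(2) d_def by blast
  qed
  then have zr: "z = complex_of_real (Re z)" by (simp add: complex_eq_iff)
  then have "poly p (Re z) = 0"
    using z unfolding P_def by (metis of_real_hom.poly_map_poly of_real_eq_0_iff)
  then obtain q where q: "p = [:- Re z, 1:] * q" by (auto simp: poly_eq_0_iff_dvd)
  then have q0: "q \<noteq> 0" using Suc.prems(1) by auto
  have "degree p = Suc (degree q)" unfolding q using q0 by (subst degree_mult_eq) auto
  then have "degree q = n" using Suc.hyps(2) by simp
  moreover have "\<not> [:a\<^sup>2 + b\<^sup>2, - 2 * a, 1:] dvd q" for a b
    using Suc.prems(2) q by (metis dvd_mult)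
  ultimately have IH: "card {x. poly q x = 0} = n" using Suc.hyps(1)[of q] q0 by simp
  have "poly q (Re z) \<noteq> 0"
  proof
    assume "poly q (Re z) = 0"
    then have "[:- Re z, 1:] dvd q" by (simp add: poly_eq_0_iff_dvd)
    then have "[:- Re z, 1:] * [:- Re z, 1:] dvd p" unfolding q by (intro mult_dvd_mono) auto
    moreover have "[:- Re z, 1:] * [:- Re z, 1:] = [:(Re z)\<^sup>2 + 0\<^sup>2, - 2 * Re z, 1:]"
      by (simp add: power2_eq_square)
    ultimately show False using Suc.prems(2) by metis
  qed
  moreover have "{x. poly p x = 0} = insert (Re z) {x. poly q x = 0}"
    unfolding q by auto
  ultimately show ?case using IH Suc.hyps(2) poly_roots_finite[OF q0] by simp
qed

lemma degree_div_le:
  fixes f p :: "'a :: field poly"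
  shows "degree (f div p) \<le> degree f - degree p"
proof (cases "f div p = 0")
  case False
  then have p0: "p \<noteq> 0" by auto
  then have *: "degree (f div p * p) = degree (f div p) + degree p"
    using False by (intro degree_mult_eq) auto
  have "degree (f div p * p + f mod p) = degree (f div p) + degree p"
  proof (cases "f mod p = 0")
    case False
    then have "degree (f mod p) < degree p"
      using degree_mod_less[OF p0, of f] by auto
    then show ?thesis
      using * by (subst degree_add_eq_left) auto
  qed (use * in simp)
  then show ?thesis by (simp add: div_mult_mod_eq)
qed simp

text \<open>A flat positive functional is a Gauss quadrature: the minimal monic null polynomial has
  simple real roots, since a factor \<open>(t - a)\<^sup>2 + b\<^sup>2\<close> with cofactor \<open>g\<close> would give
  \<open>0 = \<Lambda>(p g) = \<Lambda>(((t - a) g)\<^sup>2) + b\<^sup>2 \<Lambda>(g\<^sup>2) > 0\<close>.\<close>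

lemma flat_functional_quadrature:
  fixes p U :: "real poly"
  assumes psd: "\<And>q. degree q \<le> k \<Longrightarrow> 0 \<le> riesz \<gamma> (q * q)"
    and U: "degree U = k" "coeff U k = 1" "riesz \<gamma> (U * U) = 0" and k: "0 < k"
    and p: "degree p = r" "coeff p r = 1" "r \<le> k" "riesz \<gamma> (p * p) = 0"
    and pos: "\<And>q. q \<noteq> 0 \<Longrightarrow> degree q < r \<Longrightarrow> 0 < riesz \<gamma> (q * q)"
  shows "\<exists>T c. finite T \<and> card T = r \<and> (\<forall>t\<in>T. 0 < c t) \<and>
    (\<forall>n\<le>2 * k. \<gamma> n = (\<Sum>t\<in>T. c t * t ^ n))"
proof -
  have p0: "p \<noteq> 0" using p(2) by auto
  have null: "riesz \<gamma> (q * f) = 0" if "degree q \<le> k" "riesz \<gamma> (q * q) = 0" "degree f \<le> k" for q f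
    using riesz_null[of k \<gamma> q f] psd that by blast
  have monom_Suc_mult: "monom (1::real) (Suc e) = monom 1 e * monom 1 1" for e
    by (simp add: mult_monom)
  have shift: "riesz \<gamma> (p * monom 1 e * g) = 0" if "r + e \<le> k" "degree g \<le> k" for e g
    using that
  proof (induction e arbitrary: g)
    case 0
    then show ?case using null[of p g] p by simp
  next
    case (Suc e)
    \<comment> \<open>Here flatness enters: t g may exceed degree k, but subtracting a multiple of
      the null polynomial \<open>U\<close> lowers g below degree k at no cost. One factor t can then
      be moved from p t^(e+1) to the test polynomial.\<close>
    define h where "h = g - smult (coeff g k) U"
    have "degree h < k" unfolding h_def using Suc.prems U k by (intro degree_minus_lead_lt) auto
    then have "degree (monom 1 1 * h) \<le> k"
      using degree_mult_le[of "monom (1::real) 1" h] by (simp add: degree_monom_eq)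
    then have "riesz \<gamma> (p * monom 1 e * (monom 1 1 * h)) = 0"
      using Suc by simp
    moreover have e: "p * monom 1 e * (monom 1 1 * h) = p * monom 1 (Suc e) * h"
      by (simp only: monom_Suc_mult[of e] mult_ac)
    ultimately have "riesz \<gamma> (p * monom 1 (Suc e) * h) = 0"
      by (simp only: e)
    moreover have "riesz \<gamma> (U * (p * monom 1 (Suc e))) = 0"
    proof (rule null)
      have "degree (p * monom 1 (Suc e)) \<le> r + Suc e"
        using degree_mult_le[of p "monom 1 (Suc e)"] p(1) by (simp add: degree_monom_eq)
      then show "degree (p * monom 1 (Suc e)) \<le> k" using Suc.prems by simp
    qed (use U in auto)
    moreover have "p * monom 1 (Suc e) * g = p * monom 1 (Suc e) * h
        + smult (coeff g k) (U * (p * monom 1 (Suc e)))"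
      by (simp add: h_def algebra_simps)
    ultimately show ?case by (simp add: riesz_linear)
  qed
  have ortho: "riesz \<gamma> (p * f) = 0" if "degree f \<le> 2 * k - r" for f
  proof (rule riesz_mult_eq_0[OF _ that])
    fix j assume j: "j \<le> 2 * k - r"
    \<comment> \<open>The power t^j is split: at most k - r factors stay with p, and what is left
      has degree at most (2k - r) - (k - r) = k.\<close>
    have "riesz \<gamma> (p * monom 1 (min j (k - r)) * monom 1 (j - min j (k - r))) = 0"
      using j p by (intro shift) (auto simp: degree_monom_eq)
    then show "riesz \<gamma> (p * monom 1 j) = 0"
      by (simp add: mult.assoc mult_monom)
  qed
  define T where "T = {x. poly p x = 0}"
  have finT: "finite T" unfolding T_def using p0 by (rule poly_roots_finite)
  have "card T = degree p"
    unfolding T_def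
  proof (rule degree_eq_card_real_roots[OF p0])
    fix a b
    show "\<not> [:a\<^sup>2 + b\<^sup>2, - 2 * a, 1:] dvd p"
    proof
      assume "[:a\<^sup>2 + b\<^sup>2, - 2 * a, 1:] dvd p"
      then obtain g where g: "p = [:a\<^sup>2 + b\<^sup>2, - 2 * a, 1:] * g" by blast
      then have g0: "g \<noteq> 0" using p0 by auto
      have dg: "r = degree g + 2"
        using p(1) g0 unfolding g by (subst (asm) degree_mult_eq) auto
      have dg': "degree ([:- a, 1:] * g) = degree g + 1"
        using g0 by (subst degree_mult_eq) auto
      have "[:a\<^sup>2 + b\<^sup>2, - 2 * a, 1:] = [:- a, 1:] * [:- a, 1:] + [:b\<^sup>2:]"
        by (simp add: power2_eq_square)
      then have "p * g = ([:- a, 1:] * [:- a, 1:] + [:b\<^sup>2:]) * g * g"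
        unfolding g by (simp only:)
      also have "\<dots> = ([:- a, 1:] * g) * ([:- a, 1:] * g) + [:b\<^sup>2:] * g * g"
        by (simp only: ring_distribs mult_ac)
      finally have "p * g = ([:- a, 1:] * g) * ([:- a, 1:] * g) + smult (b\<^sup>2) (g * g)"
        by simp
      moreover have "0 < riesz \<gamma> (([:- a, 1:] * g) * ([:- a, 1:] * g))"
        using dg dg' g0 by (intro pos) auto
      moreover have "0 < riesz \<gamma> (g * g)"
        using dg g0 by (intro pos) auto
      moreover have "riesz \<gamma> (p * g) = 0"
        using dg p(3) by (intro ortho) auto
      moreover have "0 \<le> b\<^sup>2 * riesz \<gamma> (g * g)"
        using calculation(3) by simp
      ultimately show False
        by (simp only: riesz_add riesz_smult)
    qed
  qed
  then have cardT: "card T = r" using p(1) by simp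
  \<comment> \<open>The Lagrange basis at the roots of p.\<close>
  define l where "l t = smult (1 / (\<Prod>s\<in>T - {t}. t - s)) (\<Prod>s\<in>T - {t}. [:- s, 1:])" for t
  have l_same: "poly (l t) t = 1" if "t \<in> T" for t
    using finT by (simp add: l_def poly_prod)
  have l_diff: "poly (l t) s = 0" if "s \<in> T" "s \<noteq> t" for s t
    using finT that by (auto simp: l_def poly_prod)
  have deg_l: "degree (l t) < r" if "t \<in> T" for t
  proof -
    have "degree (\<Prod>s\<in>T - {t}. [:- s, 1:]) \<le> (\<Sum>s\<in>T - {t}. degree [:- s, 1:])"
      using degree_prod_sum_le[of "T - {t}" "\<lambda>s. [:- s, 1:]"] finT by (simp add: o_def)
    also have "\<dots> = card T - 1" using finT that by simp
    finally show ?thesis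
      using cardT finT that card_gt_0_iff[of T] unfolding l_def
      by (auto intro: le_less_trans[OF degree_smult_le])
  qed
  have interp: "h = (\<Sum>t\<in>T. smult (poly h t) (l t))" if "degree h < r" for h
  proof -
    let ?d = "h - (\<Sum>t\<in>T. smult (poly h t) (l t))"
    have "degree (\<Sum>t\<in>T. smult (poly h t) (l t)) < r"
      using deg_l that finT by (intro degree_sum_less) (auto intro: le_less_trans[OF degree_smult_le])
    then have d: "degree ?d < r" using that by (rule degree_diff_less[rotated])
    have "poly ?d x = 0" if "x \<in> T" for x
    proof -
      have "(\<Sum>t\<in>T. poly h t * poly (l t) x) = (\<Sum>t\<in>T. if t = x then poly h x else 0)"
        using l_same l_diff that by (intro sum.cong) auto
      also have "\<dots> = poly h x" using finT that by (subst sum.delta) auto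
      finally show ?thesis by (simp only: poly_diff poly_sum poly_smult diff_self)
    qed
    then have sub: "T \<subseteq> {x. poly ?d x = 0}" by blast
    have "?d = 0"
    proof (rule ccontr)
      assume d0: "?d \<noteq> 0"
      have "card T \<le> degree ?d"
        using card_mono[OF poly_roots_finite[OF d0] sub] card_poly_roots_bound[OF d0] by linarith
      then show False using d cardT by linarith
    qed
    then show ?thesis by (simp only: right_minus_eq)
  qed
  define c where "c t = riesz \<gamma> (l t)" for t
  have quad: "riesz \<gamma> f = (\<Sum>t\<in>T. c t * poly f t)" if "degree f \<le> 2 * k" for f
  proof (cases "r = 0")
    \<comment> \<open>For r = 0 the remainder cannot have degree below r. Here p = 1, so
      orthogonality already makes \<Lambda> vanish up to degree 2k, in accordance with the empty
      sum.\<close>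
    case True
    then have "p = 1" using p by (metis degree_eq_zeroE coeff_pCons_0 one_pCons)
    moreover have "T = {}" using True cardT finT by simp
    ultimately show ?thesis using ortho[of f] that True by simp
  next
    case False
    have f: "f = p * (f div p) + f mod p" by simp
    have "degree (f div p) \<le> 2 * k - r"
      using that p degree_div_le[of f p] by simp
    then have "riesz \<gamma> (p * (f div p)) = 0" by (rule ortho)
    moreover have "degree (f mod p) < r"
      using degree_mod_less[of p f] p0 p(1) False by auto
    then have "riesz \<gamma> (f mod p) = (\<Sum>t\<in>T. riesz \<gamma> (smult (poly (f mod p) t) (l t)))"
      by (subst interp) (auto simp: riesz_sum)
    moreover have "poly (f mod p) t = poly f t" if "t \<in> T" for t
      using that by (subst (2) f) (simp only: poly_add poly_mult, simp add: T_def)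
    moreover have "riesz \<gamma> f = riesz \<gamma> (p * (f div p)) + riesz \<gamma> (f mod p)"
      by (subst f) (rule riesz_add)
    ultimately show ?thesis
      by (simp add: riesz_smult c_def mult.commute)
  qed
  have "0 < c t" if t: "t \<in> T" for t
  proof -
    \<comment> \<open>The rule applied to the square of a Lagrange polynomial isolates a single
      weight, so positivity below degree r makes the weight positive.\<close>
    have "riesz \<gamma> (l t * l t) = (\<Sum>s\<in>T. c s * poly (l t * l t) s)"
      using deg_l[OF t] p(3) by (intro quad order.trans[OF degree_mult_le]) auto
    also have "\<dots> = (\<Sum>s\<in>T. if s = t then c t else 0)"
      using l_same l_diff t by (intro sum.cong) auto
    finally have "riesz \<gamma> (l t * l t) = c t" using finT t by simp
    moreover have "l t \<noteq> 0" using l_same[OF t] by auto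
    ultimately show ?thesis using pos[of "l t"] deg_l[OF t] by simp
  qed
  moreover have "\<gamma> n = (\<Sum>t\<in>T. c t * t ^ n)" if "n \<le> 2 * k" for n
    using quad[of "monom 1 n"] that by (simp add: degree_monom_eq poly_monom)
  ultimately show ?thesis using finT cardT by blast
qed

section \<open>The rank of a sequence\<close>

lemma invertible_mat_if_trivial_kernel:
  fixes A :: "real mat"
  assumes A: "A \<in> carrier_mat n n"
    and ker: "\<And>v. v \<in> carrier_vec n \<Longrightarrow> A *\<^sub>v v = 0\<^sub>v n \<Longrightarrow> v = 0\<^sub>v n"
  shows "invertible_mat A"
proof -
  have "det A \<noteq> 0"
    using det_0_iff_vec_prod_zero_field[OF A] ker by auto
  then have "A \<in> Units (ring_mat TYPE(real) n ())"
    by (rule det_non_zero_imp_unit[OF A])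
  then obtain B where "B \<in> carrier_mat n n" "B * A = 1\<^sub>m n" "A * B = 1\<^sub>m n"
    by (auto simp: Units_def ring_mat_def)
  then show ?thesis
    using A by (auto simp: invertible_mat_def inverts_mat_def square_mat.simps)
qed

lemma invertible_mat_kernel:
  fixes A :: "real mat"
  assumes A: "A \<in> carrier_mat n n" and inv: "invertible_mat A"
    and v: "v \<in> carrier_vec n" "A *\<^sub>v v = 0\<^sub>v n"
  shows "v = 0\<^sub>v n"
proof -
  obtain B where B: "A * B = 1\<^sub>m n" "B * A = 1\<^sub>m (dim_row B)"
    using A inv by (auto simp: invertible_mat_def inverts_mat_def)
  then have "dim_row B = n"
    using A by (metis carrier_matD(2) index_mult_mat(3) index_one_mat(3))
  moreover have "dim_col B = n"
    using B(1) by (metis index_mult_mat(3) index_one_mat(3))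
  ultimately have Bc: "B \<in> carrier_mat n n" by auto
  have "v = (B * A) *\<^sub>v v" using B Bc v by simp
  also have "\<dots> = B *\<^sub>v (A *\<^sub>v v)" using A Bc v by (intro assoc_mult_mat_vec) auto
  also have "\<dots> = 0\<^sub>v n" using v(2) Bc by (intro eq_vecI) auto
  finally show ?thesis .
qed

text \<open>Translates the rank of a sequence into polynomials: the coefficients of a linear
  dependence, with their signs changed, are the lower coefficients of the monic polynomial.\<close>

lemma hankel_col_in_span_iff:
  assumes i: "i \<le> m"
  shows "col (hankel m \<gamma>) i \<in> LinearCombinations.module.span class_ring (module_vec TYPE(real) (m + 1))
      (col (hankel m \<gamma>) ` {..<i})
    \<longleftrightarrow> (\<exists>p. degree p = i \<and> coeff p i = 1 \<and> (\<forall>j\<le>m. riesz \<gamma> (p * monom 1 j) = 0))"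
    (is "?L \<longleftrightarrow> ?R")
proof -
  interpret vec_space "TYPE(real)" "m + 1" .
  define C where "C = Matrix.mat (m + 1) i (\<lambda>(r, l). \<gamma> (r + l))"
  have C: "C \<in> carrier_mat (m + 1) i" by (simp add: C_def)
  have "col C l = col (hankel m \<gamma>) l" if "l < i" for l
    using that i by (intro eq_vecI) (auto simp: C_def hankel_def)
  then have "set (cols C) = col (hankel m \<gamma>) ` {..<i}"
    using C by (auto simp: cols_def image_iff)
  then have "?L \<longleftrightarrow> col (hankel m \<gamma>) i \<in> col_space C"
    by (simp only: col_space_def)
  also have "\<dots> \<longleftrightarrow> (\<exists>x\<in>carrier_vec i. C *\<^sub>v x = col (hankel m \<gamma>) i)"
    by (subst col_space_eq[OF C]) (use C col_dim[of "hankel m \<gamma>" i] in auto)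
  also have "\<dots> \<longleftrightarrow> (\<exists>x\<in>carrier_vec i. \<forall>j\<le>m. (\<Sum>l<i. x $ l * \<gamma> (l + j)) = \<gamma> (i + j))"
  proof (intro bex_cong refl)
    fix x :: "real vec" assume x: "x \<in> carrier_vec i"
    have "(C *\<^sub>v x) $ j = (\<Sum>l<i. x $ l * \<gamma> (l + j))" if "j \<le> m" for j
      using that x by (auto simp: C_def scalar_prod_def atLeast0LessThan mult.commute add.commute intro!: sum.cong)
    moreover have "col (hankel m \<gamma>) i $ j = \<gamma> (i + j)" if "j \<le> m" for j
      using that i by (simp add: add.commute)
    moreover have "C *\<^sub>v x = col (hankel m \<gamma>) i \<longleftrightarrow>
        (\<forall>j\<le>m. (C *\<^sub>v x) $ j = col (hankel m \<gamma>) i $ j)"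
    proof
      assume *: "\<forall>j\<le>m. (C *\<^sub>v x) $ j = col (hankel m \<gamma>) i $ j"
      show "C *\<^sub>v x = col (hankel m \<gamma>) i"
        by (rule eq_vecI) (use * in \<open>auto simp: C_def hankel_def simp del: index_mult_mat_vec\<close>)
    qed simp
    ultimately show "C *\<^sub>v x = col (hankel m \<gamma>) i \<longleftrightarrow> (\<forall>j\<le>m. (\<Sum>l<i. x $ l * \<gamma> (l + j)) = \<gamma> (i + j))"
      by simp
  qed
  also have "\<dots> \<longleftrightarrow> ?R"
  proof
    assume "\<exists>x\<in>carrier_vec i. \<forall>j\<le>m. (\<Sum>l<i. x $ l * \<gamma> (l + j)) = \<gamma> (i + j)"
    then obtain x where x: "x \<in> carrier_vec i" "\<And>j. j \<le> m \<Longrightarrow> (\<Sum>l<i. x $ l * \<gamma> (l + j)) = \<gamma> (i + j)"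
      by blast
    define p where "p = monom 1 i - vpoly x"
    have "coeff p i = 1" using x(1) by (simp add: p_def coeff_vpoly)
    moreover have "degree p \<le> i" unfolding p_def
      using x(1) by (intro degree_le) (auto simp: coeff_vpoly)
    moreover have "riesz \<gamma> (p * monom 1 j) = 0" if "j \<le> m" for j
      unfolding p_def left_diff_distrib riesz_diff riesz_vpoly_mult[OF x(1)]
      using x(2)[OF that] by (simp add: mult_monom)
    ultimately show ?R by (metis le_antisym le_degree zero_neq_one)
  next
    assume ?R
    then obtain p where p: "degree p = i" "coeff p i = 1" "\<And>j. j \<le> m \<Longrightarrow> riesz \<gamma> (p * monom 1 j) = 0"
      by blast
    define x where "x = Matrix.vec i (\<lambda>l. - coeff p l)"
    have x: "x \<in> carrier_vec i" by (simp add: x_def)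
    have px: "p = monom 1 i - vpoly x"
      by (rule poly_eqI) (use p in \<open>auto simp: x_def coeff_vpoly coeff_eq_0 not_less le_less\<close>)
    have "(\<Sum>l<i. x $ l * \<gamma> (l + j)) = \<gamma> (i + j)" if "j \<le> m" for j
      using p(3)[OF that] unfolding px left_diff_distrib riesz_diff riesz_vpoly_mult[OF x]
      by (simp add: mult_monom)
    then show "\<exists>x\<in>carrier_vec i. \<forall>j\<le>m. (\<Sum>l<i. x $ l * \<gamma> (l + j)) = \<gamma> (i + j)" using x by blast
  qed
  finally show ?thesis .
qed

lemma seq_rank_pd:
  assumes "pd_mat (hankel m \<gamma>)"
  shows "seq_rank m \<gamma> = m + 1"
proof -
  have "invertible_mat (hankel m \<gamma>)"
  proof (rule invertible_mat_if_trivial_kernel[OF hankel_carrier])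
    fix v assume v: "v \<in> carrier_vec (Suc m)" "hankel m \<gamma> *\<^sub>v v = 0\<^sub>v (Suc m)"
    then have "v \<bullet> (hankel m \<gamma> *\<^sub>v v) = 0" by simp
    then show "v = 0\<^sub>v (Suc m)"
      using assms v(1) by (force simp: pd_mat_def)
  qed
  then show ?thesis by (simp add: seq_rank_def)
qed

text \<open>For a semidefinite form, \<Lambda>(p^2) = 0 is the same as orthogonality of p to all
  degrees up to m. The first dependent column therefore sits at the least degree of a nonzero null
  polynomial.\<close>

lemma seq_rank_psd_singular:
  assumes psd: "psd_mat (hankel m \<gamma>)" and npd: "\<not> pd_mat (hankel m \<gamma>)"
  obtains p where "degree p = seq_rank m \<gamma>" "coeff p (seq_rank m \<gamma>) = 1" "seq_rank m \<gamma> \<le> m"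
    "riesz \<gamma> (p * p) = 0" "\<And>q. q \<noteq> 0 \<Longrightarrow> degree q < seq_rank m \<gamma> \<Longrightarrow> 0 < riesz \<gamma> (q * q)"
proof -
  have nonneg: "0 \<le> riesz \<gamma> (q * q)" if "degree q \<le> m" for q
    using psd that by (simp add: psd_hankel_iff)
  obtain q where q: "degree q \<le> m" "q \<noteq> 0" "riesz \<gamma> (q * q) \<le> 0"
    using npd by (auto simp: pd_hankel_iff not_less)
  then have q_null: "riesz \<gamma> (q * q) = 0" using nonneg[OF q(1)] by linarith
  have null: "riesz \<gamma> (q * f) = 0" if "degree q \<le> m" "riesz \<gamma> (q * q) = 0" "degree f \<le> m" for q f
    using riesz_null[of m \<gamma> q f] nonneg that by blast
  have "\<not> invertible_mat (hankel m \<gamma>)"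
  proof
    assume inv: "invertible_mat (hankel m \<gamma>)"
    define v where "v = Matrix.vec (Suc m) (coeff q)"
    have v: "v \<in> carrier_vec (Suc m)" "vpoly v = q"
      using q(1) by (simp_all add: v_def vpoly_vec_coeff)
    have "hankel m \<gamma> *\<^sub>v v = 0\<^sub>v (Suc m)"
    proof (rule eq_vecI)
      fix j assume "j < dim_vec (0\<^sub>v (Suc m) :: real vec)"
      then show "(hankel m \<gamma> *\<^sub>v v) $ j = 0\<^sub>v (Suc m) $ j"
        using v null[OF q(1) q_null, of "monom 1 j"]
        by (simp add: hankel_mult_vec degree_monom_eq del: index_mult_mat_vec)
    qed simp
    then have "v = 0\<^sub>v (Suc m)"
      using invertible_mat_kernel[OF hankel_carrier inv v(1)] by simp
    then show False using v q(2) vpoly_eq_0_iff[of v] by simp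
  qed
  define P where "P i \<longleftrightarrow> i \<le> m \<and> (\<exists>p. degree p = i \<and> coeff p i = 1 \<and>
    (\<forall>j\<le>m. riesz \<gamma> (p * monom 1 j) = 0))" for i
  have P_null: "P (degree f)" if f: "f \<noteq> 0" "degree f \<le> m" "riesz \<gamma> (f * f) = 0" for f
  proof -
    define g where "g = smult (1 / lead_coeff f) f"
    have "degree g = degree f" "coeff g (degree f) = 1"
      using f(1) by (simp_all add: g_def)
    moreover have "riesz \<gamma> (g * monom 1 j) = 0" if "j \<le> m" for j
      using null[OF f(2,3), of "monom 1 j"] that
      by (simp add: g_def riesz_smult degree_monom_eq)
    ultimately show ?thesis using f(2) unfolding P_def by blast
  qed
  have rank: "seq_rank m \<gamma> = (LEAST i. P i)"
    unfolding seq_rank_def P_def using \<open>\<not> invertible_mat _\<close>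
    by (simp only: if_False hankel_col_in_span_iff cong: conj_cong)
  have "P (seq_rank m \<gamma>)"
    unfolding rank using P_null[OF q(2,1) q_null] by (rule LeastI)
  then obtain p where p: "seq_rank m \<gamma> \<le> m" "degree p = seq_rank m \<gamma>" "coeff p (seq_rank m \<gamma>) = 1"
      "\<And>j. j \<le> m \<Longrightarrow> riesz \<gamma> (p * monom 1 j) = 0"
    unfolding P_def by blast
  have "riesz \<gamma> (p * p) = 0"
    by (rule riesz_mult_eq_0[of m \<gamma> p p, OF p(4)]) (simp_all add: p(1,2))
  moreover have "0 < riesz \<gamma> (f * f)" if f: "f \<noteq> 0" "degree f < seq_rank m \<gamma>" for f
  proof -
    have "\<not> P (degree f)" using f(2) unfolding rank by (rule not_less_Least)
    then show ?thesis
      using P_null[of f] nonneg[of f] f p(1) by force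
  qed
  ultimately show ?thesis using that[OF p(2,3,1)] by blast
qed

section \<open>Moore-Penrose inverses of symmetric matrices\<close>

lemma scalar_prod_self_eq_0:
  fixes z :: "real vec"
  assumes "z \<in> carrier_vec n" "z \<bullet> z = 0"
  shows "z = 0\<^sub>v n"
proof -
  have "\<forall>i\<in>{0..<dim_vec z}. z $ i * z $ i = 0"
    using assms(2) by (simp add: scalar_prod_def sum_nonneg_eq_0_iff)
  then show ?thesis using assms(1) by (intro eq_vecI) auto
qed

text \<open>Orthogonal projections onto a subspace of the kernel, not necessarily all of it; the
  trace plays the role of the dimension.\<close>

definition kernel_projection :: "real mat \<Rightarrow> real mat \<Rightarrow> bool" where
  "kernel_projection A P \<longleftrightarrow> P \<in> carrier_mat (dim_row A) (dim_row A) \<and>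
     P\<^sup>T = P \<and> P * P = P \<and> A * P = 0\<^sub>m (dim_row A) (dim_row A)"

text \<open>For a symmetric idempotent, (P_ii)^2 is one summand of (P P)_ii = P_ii, so every
  diagonal entry is at most 1.\<close>

lemma kernel_projection_trace_le:
  assumes "kernel_projection A P"
  shows "(\<Sum>i<dim_row A. P $$ (i, i)) \<le> real (dim_row A)"
proof -
  define n where "n = dim_row A"
  have P: "P \<in> carrier_mat n n" "P\<^sup>T = P" "P * P = P"
    using assms by (auto simp: kernel_projection_def n_def)
  have sym: "P $$ (j, i) = P $$ (i, j)" if "i < n" "j < n" for i j
    using P(1,2) that by (metis carrier_matD index_transpose_mat(1))
  have "P $$ (i, i) \<le> 1" if i: "i < n" for i
  proof -
    have "(P $$ (i, i))\<^sup>2 \<le> (\<Sum>j<n. (P $$ (i, j))\<^sup>2)"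
      using i by (intro member_le_sum) auto
    also have "\<dots> = (P * P) $$ (i, i)"
      using P(1) i sym by (auto simp: scalar_prod_def atLeast0LessThan power2_eq_square intro!: sum.cong)
    finally have "(P $$ (i, i))\<^sup>2 \<le> P $$ (i, i)" using P(3) by simp
    then have "0 \<le> P $$ (i, i)" by (smt (verit) zero_le_power2)
    then show ?thesis
      using \<open>(P $$ (i, i))\<^sup>2 \<le> P $$ (i, i)\<close> by (cases "P $$ (i, i) = 0") (auto simp: power2_eq_square)
  qed
  then have "(\<Sum>i<n. P $$ (i, i)) \<le> (\<Sum>i<n. 1)" by (intro sum_mono) auto
  then show ?thesis by (simp add: n_def)
qed

text \<open>As P is symmetric, P z = 0 says that z is orthogonal to the range of P. So the rank-one
  projection onto z can be added, which raises the trace by 1.\<close>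

lemma kernel_projection_extend:
  assumes A: "A \<in> carrier_mat n n" and P: "kernel_projection A P"
    and z: "z \<in> carrier_vec n" "z \<noteq> 0\<^sub>v n" "A *\<^sub>v z = 0\<^sub>v n" "P *\<^sub>v z = 0\<^sub>v n"
  shows "\<exists>P'. kernel_projection A P' \<and> (\<Sum>i<n. P' $$ (i, i)) = (\<Sum>i<n. P $$ (i, i)) + 1"
proof -
  have Pc: "P \<in> carrier_mat n n" "P\<^sup>T = P" "P * P = P" "A * P = 0\<^sub>m n n"
    using P A by (auto simp: kernel_projection_def)
  have zz: "z \<bullet> z \<noteq> 0" using scalar_prod_self_eq_0 z(1,2) by blast
  define Z where "Z = Matrix.mat n n (\<lambda>(i, j). z $ i * z $ j / (z \<bullet> z))"
  have Z: "Z \<in> carrier_mat n n" by (simp add: Z_def)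
  have ZT: "Z\<^sup>T = Z" by (rule eq_matI) (auto simp: Z_def)
  have mult_Z: "M * Z = 0\<^sub>m n n" if M: "M \<in> carrier_mat n n" "M *\<^sub>v z = 0\<^sub>v n" for M
  proof (rule eq_matI)
    fix i j assume ij: "i < dim_row (0\<^sub>m n n :: real mat)" "j < dim_col (0\<^sub>m n n :: real mat)"
    have "(M * Z) $$ (i, j) = (\<Sum>l<n. M $$ (i, l) * z $ l) * z $ j / (z \<bullet> z)"
      using ij M Z by (auto simp: Z_def scalar_prod_def atLeast0LessThan sum_distrib_right sum_divide_distrib
          intro!: sum.cong)
    also have "(\<Sum>l<n. M $$ (i, l) * z $ l) = (M *\<^sub>v z) $ i"
      using ij M(1) z(1) by (auto simp: scalar_prod_def atLeast0LessThan)
    finally show "(M * Z) $$ (i, j) = 0\<^sub>m n n $$ (i, j)" using M(2) ij by simp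
  qed (use that Z in auto)
  have ZZ: "Z * Z = Z"
  proof (rule eq_matI)
    fix i j assume ij: "i < dim_row Z" "j < dim_col Z"
    then have "i < n" "j < n" by (simp_all add: Z_def)
    then have "(Z * Z) $$ (i, j) = (\<Sum>l<n. z $ i * z $ l / (z \<bullet> z) * (z $ l * z $ j / (z \<bullet> z)))"
      by (auto simp: Z_def scalar_prod_def atLeast0LessThan)
    also have "\<dots> = (\<Sum>l<n. z $ l * z $ l) * (z $ i * z $ j) / ((z \<bullet> z) * (z \<bullet> z))"
      by (simp add: sum_distrib_left sum_divide_distrib mult_ac)
    also have "(\<Sum>l<n. z $ l * z $ l) = z \<bullet> z" using z(1) by (simp add: scalar_prod_def atLeast0LessThan)
    finally show "(Z * Z) $$ (i, j) = Z $$ (i, j)"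
      using zz \<open>i < n\<close> \<open>j < n\<close> by (simp add: Z_def)
  qed (auto simp: Z_def)
  have PZ: "P * Z = 0\<^sub>m n n" using mult_Z[OF Pc(1) z(4)] .
  then have "(P * Z)\<^sup>T = 0\<^sub>m n n" by simp
  then have ZP: "Z * P = 0\<^sub>m n n" using transpose_mult[OF Pc(1) Z] Pc(2) ZT by simp
  have "(P + Z) * (P + Z) = P + Z"
    using Pc Z ZZ PZ ZP
    by (simp add: add_mult_distrib_mat[of _ n n] mult_add_distrib_mat[of _ n n])
  moreover have "A * (P + Z) = 0\<^sub>m n n"
    using A Pc Z mult_Z[OF A z(3)] by (simp add: mult_add_distrib_mat[of _ n n])
  moreover have "(P + Z)\<^sup>T = P + Z"
    using Pc Z ZT by (simp add: transpose_add)
  ultimately have "kernel_projection A (P + Z)"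
    using A Pc Z by (simp add: kernel_projection_def)
  moreover have "(\<Sum>i<n. (P + Z) $$ (i, i)) = (\<Sum>i<n. P $$ (i, i)) + 1"
  proof -
    have "(\<Sum>i<n. Z $$ (i, i)) = (z \<bullet> z) / (z \<bullet> z)"
      using z(1) by (simp add: Z_def scalar_prod_def atLeast0LessThan flip: sum_divide_distrib)
    then show ?thesis using Pc Z zz by (simp add: sum.distrib)
  qed
  ultimately show ?thesis by blast
qed

text \<open>The Moore-Penrose inverse of a symmetric matrix is \<open>(A + P)\<^sup>-\<^sup>1 - P\<close>, where \<open>P\<close> is the orthogonal
  projection onto the kernel; \<open>P\<close> is a symmetric idempotent of maximal trace with \<open>A P = 0\<close>.\<close>

lemma symmetric_moore_penrose_exists:
  assumes A: "A \<in> carrier_mat n n" "A\<^sup>T = A"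
  shows "\<exists>X. is_moore_penrose A X"
proof -
  have "\<exists>P. kernel_projection A P \<and> (\<forall>z\<in>carrier_vec n. A *\<^sub>v z = 0\<^sub>v n \<longrightarrow> P *\<^sub>v z = 0\<^sub>v n \<longrightarrow> z = 0\<^sub>v n)"
  proof (rule ccontr)
    assume none: "\<not> ?thesis"
    \<comment> \<open>If every projection left some kernel vector uncovered, traces could be raised
      by 1 forever; trace n + 1 contradicts the bound n.\<close>
    have "\<exists>P. kernel_projection A P \<and> (\<Sum>i<n. P $$ (i, i)) = real m" for m
    proof (induction m)
      case 0
      show ?case using A by (intro exI[of _ "0\<^sub>m n n"]) (auto simp: kernel_projection_def)
    next
      case (Suc m)
      then obtain P where P: "kernel_projection A P" "(\<Sum>i<n. P $$ (i, i)) = real m" by blast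
      then obtain z where "z \<in> carrier_vec n" "z \<noteq> 0\<^sub>v n" "A *\<^sub>v z = 0\<^sub>v n" "P *\<^sub>v z = 0\<^sub>v n"
        using none by blast
      from kernel_projection_extend[OF A(1) P(1) this] P(2) show ?case by auto
    qed
    then obtain P where "kernel_projection A P" "(\<Sum>i<n. P $$ (i, i)) = real (n + 1)" by blast
    then show False using kernel_projection_trace_le[of A P] A by simp
  qed
  then obtain P where "kernel_projection A P"
    and full: "\<And>z. z \<in> carrier_vec n \<Longrightarrow> A *\<^sub>v z = 0\<^sub>v n \<Longrightarrow> P *\<^sub>v z = 0\<^sub>v n \<Longrightarrow> z = 0\<^sub>v n"
    by blast
  then have P: "P \<in> carrier_mat n n" "P\<^sup>T = P" "P * P = P" and AP: "A * P = 0\<^sub>m n n"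
    using A by (auto simp: kernel_projection_def)
  have "(A * P)\<^sup>T = 0\<^sub>m n n" using AP by simp
  then have PA: "P * A = 0\<^sub>m n n" using transpose_mult[OF A(1) P(1)] P(2) A(2) by simp
  define M where "M = A + P"
  have M: "M \<in> carrier_mat n n" using A P by (simp add: M_def)
  have MP: "M * P = P" and PM: "P * M = P"
    using A P AP PA by (simp_all add: M_def add_mult_distrib_mat[of _ n n] mult_add_distrib_mat[of _ n n])
  have "invertible_mat M"
  proof (rule invertible_mat_if_trivial_kernel[OF M])
    fix v assume v: "v \<in> carrier_vec n" "M *\<^sub>v v = 0\<^sub>v n"
    have "P *\<^sub>v v = (P * M) *\<^sub>v v" by (simp add: PM)
    also have "\<dots> = P *\<^sub>v (M *\<^sub>v v)" using P M v by (intro assoc_mult_mat_vec) auto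
    also have "\<dots> = 0\<^sub>v n" using P v(2) by (intro eq_vecI) auto
    finally have Pv: "P *\<^sub>v v = 0\<^sub>v n" .
    moreover have "A *\<^sub>v v = 0\<^sub>v n"
      using v Pv A P by (simp add: M_def add_mult_distrib_mat_vec[of _ n n])
    ultimately show "v = 0\<^sub>v n" using full v(1) by blast
  qed
  then obtain Y where Y0: "M * Y = 1\<^sub>m (dim_row M)" "Y * M = 1\<^sub>m (dim_row Y)"
    by (auto simp: invertible_mat_def inverts_mat_def)
  then have Y: "Y \<in> carrier_mat n n"
    using M by (metis carrier_matD carrier_matI index_mult_mat(3) index_one_mat(3))
  have MY: "M * Y = 1\<^sub>m n" and YM: "Y * M = 1\<^sub>m n" using Y0 M Y by auto
  have YP: "Y * P = P"
  proof -
    have "Y * P = Y * (M * P)" by (simp add: MP)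
    also have "\<dots> = (Y * M) * P" using Y M P by (intro assoc_mult_mat[symmetric]) auto
    finally show ?thesis using YM P by simp
  qed
  have PY: "P * Y = P"
  proof -
    have "P * Y = (P * M) * Y" by (simp add: PM)
    also have "\<dots> = P * (M * Y)" using Y M P by (intro assoc_mult_mat) auto
    finally show ?thesis using MY P by simp
  qed
  define X where "X = Y - P"
  have X: "X \<in> carrier_mat n n" using P by (simp add: X_def minus_carrier_mat)
  have MA: "A = M - P"
    using A P by (intro eq_matI) (auto simp: M_def)
  have AX: "A * X = 1\<^sub>m n - P"
  proof -
    have "A * X = A * Y - A * P"
      unfolding X_def using A Y P by (intro mult_minus_distrib_mat) auto
    also have "\<dots> = A * Y" using A Y AP by (intro eq_matI) auto
    also have "\<dots> = M * Y - P * Y"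
      unfolding MA using M P Y by (intro minus_mult_distrib_mat) auto
    finally show ?thesis by (simp add: MY PY)
  qed
  have XA: "X * A = 1\<^sub>m n - P"
  proof -
    have "X * A = Y * A - P * A"
      unfolding X_def using A Y P by (intro minus_mult_distrib_mat) auto
    also have "\<dots> = Y * A" using A Y PA by (intro eq_matI) auto
    also have "\<dots> = Y * M - Y * P"
      unfolding MA using M P Y by (intro mult_minus_distrib_mat) auto
    finally show ?thesis by (simp add: YM YP)
  qed
  have "(1\<^sub>m n - P)\<^sup>T = 1\<^sub>m n - P"
  proof (rule eq_matI)
    fix i j assume "i < dim_row (1\<^sub>m n - P)" "j < dim_col (1\<^sub>m n - P)"
    moreover have "P $$ (j, i) = P\<^sup>T $$ (i, j)" if "i < n" "j < n"
      using P(1) that by simp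
    ultimately show "(1\<^sub>m n - P)\<^sup>T $$ (i, j) = (1\<^sub>m n - P) $$ (i, j)"
      using P by auto
  qed (use P in auto)
  moreover have "A * X * A = A"
  proof -
    have "A * X * A = 1\<^sub>m n * A - P * A"
      unfolding AX using A P by (intro minus_mult_distrib_mat) auto
    then show ?thesis using A PA by (auto intro!: eq_matI)
  qed
  moreover have "X * A * X = X"
  proof -
    have "X * A * X = 1\<^sub>m n * X - P * X"
      unfolding XA using X P by (intro minus_mult_distrib_mat) auto
    also have "P * X = P * Y - P * P"
      unfolding X_def using P Y by (intro mult_minus_distrib_mat) auto
    also have "\<dots> = 0\<^sub>m n n" using P by (simp add: PY)
    finally show ?thesis using X by (auto intro!: eq_matI)
  qed
  ultimately show ?thesis
    using A X by (intro exI[of _ X]) (simp add: is_moore_penrose_def AX XA)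
qed

lemma is_moore_penrose_pinv:
  assumes "A \<in> carrier_mat n n" "A\<^sup>T = A"
  shows "is_moore_penrose A (pinv A)"
  unfolding pinv_def using symmetric_moore_penrose_exists[OF assms] is_moore_penrose_unique
  by (metis (mono_tags, lifting) theI)

text \<open>The residual z = q - A (\<open>pinv A\<close> q) lies in the kernel of A. By symmetry it
  is orthogonal to the range of A, and by assumption to q, hence to itself.\<close>

lemma symmetric_pinv_solves:
  assumes A: "A \<in> carrier_mat n n" "A\<^sup>T = A" and q: "q \<in> carrier_vec n"
    and ker: "\<And>z. z \<in> carrier_vec n \<Longrightarrow> A *\<^sub>v z = 0\<^sub>v n \<Longrightarrow> q \<bullet> z = 0"
  shows "A *\<^sub>v (pinv A *\<^sub>v q) = q" "pinv A *\<^sub>v q \<in> carrier_vec n"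
proof -
  define X where "X = pinv A"
  have X: "X \<in> carrier_mat n n" "A * X * A = A" "(A * X)\<^sup>T = A * X"
    using is_moore_penrose_pinv[OF A] A(1) by (auto simp: is_moore_penrose_def X_def)
  then show "pinv A *\<^sub>v q \<in> carrier_vec n" using q unfolding X_def[symmetric] by simp
  have "(A * X * A)\<^sup>T = A\<^sup>T * (A * X)\<^sup>T" using A X by (intro transpose_mult) auto
  then have AAX: "A * (A * X) = A" using X A by simp
  define z where "z = q - A *\<^sub>v (X *\<^sub>v q)"
  have z: "z \<in> carrier_vec n" using A q X by (simp add: z_def)
  have "A *\<^sub>v z = A *\<^sub>v q - A *\<^sub>v (A *\<^sub>v (X *\<^sub>v q))"
    unfolding z_def using A X q by (intro mult_minus_distrib_mat_vec) auto
  also have "A *\<^sub>v (A *\<^sub>v (X *\<^sub>v q)) = (A * (A * X)) *\<^sub>v q"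
    using A X q by (simp add: assoc_mult_mat_vec[of _ n n _ n])
  finally have Az: "A *\<^sub>v z = 0\<^sub>v n" using A q AAX by simp
  have "z \<bullet> z = z \<bullet> (q - A *\<^sub>v (X *\<^sub>v q))"
    by (subst (2) z_def) (rule refl)
  also have "\<dots> = z \<bullet> q - z \<bullet> (A *\<^sub>v (X *\<^sub>v q))"
    using A X q z by (intro scalar_prod_minus_distrib) auto
  also have "z \<bullet> q = 0" using ker[OF z Az] z q by (simp add: comm_scalar_prod)
  also have "z \<bullet> (A *\<^sub>v (X *\<^sub>v q)) = (A\<^sup>T *\<^sub>v z) \<bullet> (X *\<^sub>v q)"
    using A X q z by (intro transpose_vec_mult_scalar[symmetric]) auto
  also have "\<dots> = 0" using A(2) Az X q by simp
  finally have "z = 0\<^sub>v n" using scalar_prod_self_eq_0[OF z] by simp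
  then have "q - A *\<^sub>v (X *\<^sub>v q) = 0\<^sub>v n" by (simp add: z_def)
  then have "(q - A *\<^sub>v (X *\<^sub>v q)) $ i = 0" if "i < n" for i
    using that by simp
  then show "A *\<^sub>v (pinv A *\<^sub>v q) = q"
    unfolding X_def[symmetric] using A X q by (intro eq_vecI) auto
qed

lemma symmetric_solvable_kernel:
  fixes A :: "real mat"
  assumes A: "A \<in> carrier_mat n n" "A\<^sup>T = A" and x: "x \<in> carrier_vec n" "A *\<^sub>v x = q"
    and z: "z \<in> carrier_vec n" "A *\<^sub>v z = 0\<^sub>v n"
  shows "q \<bullet> z = 0"
proof -
  have "(A\<^sup>T *\<^sub>v x) \<bullet> z = x \<bullet> (A *\<^sub>v z)"
    using A x z by (intro transpose_vec_mult_scalar) auto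
  then show ?thesis using A x z by simp
qed

section \<open>Ranks of bordered matrices\<close>

context vec_space
begin

lemma maximal_indpt_cols:
  obtains S where "maximal S (\<lambda>T. T \<subseteq> set (cols C) \<and> lin_indpt T)"
  using maximal_exists_superset[of "set (cols C)" "\<lambda>T. T \<subseteq> set (cols C) \<and> lin_indpt T" "{}"]
    finite_lin_indpt2[of "{}"] by auto

text \<open>Columns enter only as a set, so order and repetitions do not matter. Outside the column
  space, v enlarges a maximal independent set of columns of C; inside it, the span does not
  change.\<close>

lemma rank_append_col_iff:
  assumes C: "C \<in> carrier_mat n c" and M: "M \<in> carrier_mat n d"
    and cols: "set (cols M) = insert v (set (cols C))"
  shows "rank M = rank C \<longleftrightarrow> v \<in> col_space C"
proof
  have Cc: "set (cols C) \<subseteq> carrier_vec n" using cols_dim C by blast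
  have Mc: "set (cols M) \<subseteq> carrier_vec n" using cols_dim M by blast
  then have v: "v \<in> carrier_vec n" using cols by auto
  show "v \<in> col_space C" if eq: "rank M = rank C"
  proof (rule ccontr)
    assume nin: "v \<notin> col_space C"
    obtain S where S: "maximal S (\<lambda>T. T \<subseteq> set (cols C) \<and> lin_indpt T)"
      by (rule maximal_indpt_cols)
    then have S': "S \<subseteq> set (cols C)" "lin_indpt S" by (auto simp: maximal_def)
    then have "span S \<subseteq> col_space C" unfolding col_space_def by (intro span_is_monotone)
    then have "v \<notin> span S" using nin by blast
    moreover have "v \<notin> S"
      using nin S'(1) in_own_span[of "set (cols C)"] Cc unfolding col_space_def by auto
    ultimately have "lin_indpt (S \<union> {v})"
      using lin_dep_iff_in_span[of S v] S' Cc v by auto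
    then have "card (S \<union> {v}) \<le> rank M"
      using S' cols by (intro rank_ge_card_indpt[OF M]) auto
    moreover have "finite S" using S'(1) finite_subset by blast
    ultimately show False
      using eq rank_card_indpt[OF C S] \<open>v \<notin> S\<close> by simp
  qed
  show "rank M = rank C" if "v \<in> col_space C"
  proof -
    have "span (set (cols M)) = span (set (cols C))"
    proof
      show "span (set (cols C)) \<subseteq> span (set (cols M))"
        unfolding cols by (intro span_is_monotone) auto
      have "set (cols M) \<subseteq> span (set (cols C))"
        unfolding cols using that in_own_span[of "set (cols C)"] Cc by (auto simp: col_space_def)
      then show "span (set (cols M)) \<subseteq> span (set (cols C))"
        using Cc by (intro span_is_subset span_is_submodule) auto
    qed
    then show ?thesis by (simp add: rank_def)
  qed
qed

end

text \<open>Every column of E A is the image of a column of A, and E would carry a dependence among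
  chosen preimages to a dependence among the images.\<close>

lemma rank_mult_le:
  fixes A E :: "'a :: field mat"
  assumes A: "A \<in> carrier_mat n c" and E: "E \<in> carrier_mat m n"
  shows "vec_space.rank m (E * A) \<le> vec_space.rank n A"
proof -
  interpret V: vec_space "TYPE('a)" n .
  interpret W: vec_space "TYPE('a)" m .
  have EA: "E * A \<in> carrier_mat m c" using A E by simp
  obtain U where U: "maximal U (\<lambda>T. T \<subseteq> set (cols (E * A)) \<and> W.lin_indpt T)"
    by (rule W.maximal_indpt_cols)
  then have U': "U \<subseteq> set (cols (E * A))" "W.lin_indpt U" by (auto simp: maximal_def)
  have finU: "finite U" using U'(1) finite_subset by blast
  have Uc: "U \<subseteq> carrier_vec m" using U'(1) cols_dim[of "E * A"] E by auto
  have "\<exists>a\<in>set (cols A). E *\<^sub>v a = u" if "u \<in> U" for u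
  proof -
    have "u \<in> set (cols (E * A))" using that U'(1) by blast
    then obtain j where j: "j < c" "u = col (E * A) j"
      using EA by (auto simp: cols_def)
    have "u = E *\<^sub>v col A j"
      unfolding j(2) using A E j(1) by (intro eq_vecI) auto
    then show ?thesis using j A by (auto simp: cols_def)
  qed
  then obtain g where g: "\<And>u. u \<in> U \<Longrightarrow> g u \<in> set (cols A)" "\<And>u. u \<in> U \<Longrightarrow> E *\<^sub>v g u = u"
    by metis
  have inj: "inj_on g U" by (rule inj_onI) (metis g(2))
  have gc: "g ` U \<subseteq> carrier_vec n" using g(1) cols_dim[of A] A by auto
  have "V.lin_indpt (g ` U)"
  proof (rule V.finite_lin_indpt2)
    fix a assume a: "V.lincomb a (g ` U) = 0\<^sub>v n"
    have lincomb_0: "W.lincomb (a \<circ> g) U = 0\<^sub>v m"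
    proof (rule eq_vecI)
      fix i assume "i < dim_vec (0\<^sub>v m :: 'a vec)"
      then have i: "i < m" by simp
      have "W.lincomb (a \<circ> g) U $ i = (\<Sum>u\<in>U. a (g u) * u $ i)"
        using i Uc by (simp add: W.lincomb_index)
      also have "\<dots> = (\<Sum>u\<in>U. a (g u) * (\<Sum>j<n. E $$ (i, j) * g u $ j))"
      proof (intro sum.cong refl)
        fix u assume u: "u \<in> U"
        have "u $ i = (E *\<^sub>v g u) $ i" using g(2)[OF u] by simp
        also have "\<dots> = (\<Sum>j<n. E $$ (i, j) * g u $ j)"
          using i E gc u by (auto simp: scalar_prod_def atLeast0LessThan)
        finally show "a (g u) * u $ i = a (g u) * (\<Sum>j<n. E $$ (i, j) * g u $ j)" by simp
      qed
      also have "\<dots> = (\<Sum>j<n. E $$ (i, j) * (\<Sum>u\<in>U. a (g u) * g u $ j))"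
        by (simp add: sum_distrib_left mult_ac) (rule sum.swap)
      also have "\<dots> = (\<Sum>j<n. E $$ (i, j) * V.lincomb a (g ` U) $ j)"
        using gc inj by (intro sum.cong) (auto simp: V.lincomb_index sum.reindex)
      also have "\<dots> = 0" unfolding a by simp
      finally show "W.lincomb (a \<circ> g) U $ i = 0\<^sub>v m $ i" using i by simp
    qed (use W.lincomb_dim[OF finU] Uc in auto)
    have "\<forall>u\<in>U. (a \<circ> g) u = 0"
    proof (intro ballI, rule ccontr)
      fix u assume "u \<in> U" "(a \<circ> g) u \<noteq> 0"
      then have "W.lin_dep U"
        using finU lincomb_0
        by (intro W.lin_dep_crit[where A = U and a = "a \<circ> g" and v = u]) auto
      then show False using U'(2) by blast
    qed
    then show "\<forall>v\<in>g ` U. a v = 0" by simp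
  qed (use finU gc in auto)
  then have "card (g ` U) \<le> V.rank A"
    using g(1) by (intro V.rank_ge_card_indpt[OF A]) auto
  then show ?thesis
    using W.rank_card_indpt[OF EA U] card_image[OF inj] by simp
qed

text \<open>Rows are dropped and added by left multiplication.\<close>

lemma bordered_rank_eq_iff:
  fixes A :: "real mat"
  assumes A: "A \<in> carrier_mat n n" "A\<^sup>T = A" and q: "q \<in> carrier_vec n"
    and M: "M = four_block_mat A (mat_of_row q)\<^sup>T (mat_of_row q) (Matrix.mat 1 1 (\<lambda>_. d))"
  shows "mat_rank A = mat_rank M \<longleftrightarrow> (\<exists>x\<in>carrier_vec n. A *\<^sub>v x = q \<and> q \<bullet> x = d)"
proof -
  interpret V: vec_space "TYPE(real)" n .
  interpret W: vec_space "TYPE(real)" "n + 1" .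
  have Mc: "M \<in> carrier_mat (n + 1) (n + 1)" unfolding M using A by (intro four_block_carrier_mat) auto
  have rM: "mat_rank M = W.rank M" "mat_rank A = V.rank A" using A Mc by auto
  \<comment> \<open>\<open>C\<close> is \<open>M\<close> without its last column, that is,
    \<open>A\<close> with the row q appended, and \<open>v\<close> is that last column. Ranks
    increase from \<open>A\<close> to \<open>C\<close> to \<open>M\<close>, so equality of the outer
    two forces equality at each step.\<close>
  define C where "C = Matrix.mat (n + 1) n (\<lambda>(i, j). if i < n then A $$ (i, j) else q $ j)"
  define v where "v = Matrix.vec (n + 1) (\<lambda>i. if i < n then q $ i else d)"
  have C: "C \<in> carrier_mat (n + 1) n" by (simp add: C_def)
  have "col M j = (if j < n then col C j else v)" if "j < n + 1" for j
    using that A q by (intro eq_vecI) (auto simp: M C_def v_def)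
  then have "cols M = map (\<lambda>j. if j < n then col C j else v) [0..<n + 1]"
    using Mc by (auto simp: cols_def)
  moreover have "cols C = map (\<lambda>j. if j < n then col C j else v) [0..<n]"
    using C by (auto simp: cols_def)
  ultimately have cols: "set (cols M) = insert v (set (cols C))" by simp
  have C_le_M: "W.rank C \<le> W.rank M"
  proof -
    obtain S where S: "maximal S (\<lambda>T. T \<subseteq> set (cols C) \<and> W.lin_indpt T)"
      by (rule W.maximal_indpt_cols)
    then show ?thesis
      unfolding W.rank_card_indpt[OF C S] using cols
      by (intro W.rank_ge_card_indpt[OF Mc]) (auto simp: maximal_def)
  qed
  define E where "E = Matrix.mat n (n + 1) (\<lambda>(i, j). if i = j then 1 else 0 :: real)"
  have "A = E * C"
    using A by (intro eq_matI) (auto simp: E_def C_def scalar_prod_def if_distrib[of "\<lambda>x. x * _"] cong: if_cong)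
  then have A_le_C: "V.rank A \<le> W.rank C"
    using rank_mult_le[OF C, of E n] by (simp add: E_def)
  have Cx: "C *\<^sub>v x = v \<longleftrightarrow> A *\<^sub>v x = q \<and> q \<bullet> x = d" if x: "x \<in> carrier_vec n" for x
  proof -
    have 1: "(C *\<^sub>v x) $ i = (A *\<^sub>v x) $ i" if "i < n" for i
      using that A x by (auto simp: C_def scalar_prod_def)
    have 2: "(C *\<^sub>v x) $ n = q \<bullet> x"
      using x q by (auto simp: C_def scalar_prod_def)
    show ?thesis
    proof
      assume *: "C *\<^sub>v x = v"
      have "A *\<^sub>v x = q"
        by (rule eq_vecI) (use 1 * A q in \<open>auto simp: v_def simp del: index_mult_mat_vec\<close>)
      moreover have "q \<bullet> x = d" using 2 * by (simp add: v_def)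
      ultimately show "A *\<^sub>v x = q \<and> q \<bullet> x = d" ..
    next
      assume *: "A *\<^sub>v x = q \<and> q \<bullet> x = d"
      show "C *\<^sub>v x = v"
      proof (rule eq_vecI)
        fix i assume "i < dim_vec v"
        then have "i < n \<or> i = n" by (auto simp: v_def)
        then show "(C *\<^sub>v x) $ i = v $ i"
          using 1[of i] 2 * by (auto simp: v_def simp del: index_mult_mat_vec)
      qed (simp add: C_def v_def)
    qed
  qed
  have v: "v \<in> carrier_vec (n + 1)" by (simp add: v_def)
  have span_iff: "W.rank M = W.rank C \<longleftrightarrow> (\<exists>x\<in>carrier_vec n. A *\<^sub>v x = q \<and> q \<bullet> x = d)"
    unfolding W.rank_append_col_iff[OF C Mc cols] W.col_space_eq[OF C]
    using C v Cx by auto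
  show ?thesis
  proof
    assume "mat_rank A = mat_rank M"
    then show "\<exists>x\<in>carrier_vec n. A *\<^sub>v x = q \<and> q \<bullet> x = d"
      using span_iff A_le_C C_le_M rM by simp
  next
    assume R: "\<exists>x\<in>carrier_vec n. A *\<^sub>v x = q \<and> q \<bullet> x = d"
    then obtain x where x: "x \<in> carrier_vec n" "A *\<^sub>v x = q" by blast
    \<comment> \<open>By symmetry of \<open>A\<close>, the equation A x = q also says that q is the
      combination of the rows of \<open>A\<close> with coefficients x, so the appended row of
      \<open>C\<close> is recovered by a last row x.\<close>
    define F where "F = Matrix.mat (n + 1) n (\<lambda>(i, j). if i < n then (if i = j then 1 else 0) else x $ j)"
    have "C = F * A"
    proof (rule eq_matI)
      fix i j assume "i < dim_row (F * A)" "j < dim_col (F * A)"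
      then have ij: "i < n + 1" "j < n" using A by (auto simp: F_def)
      have "q $ j = (\<Sum>l<n. x $ l * A $$ (l, j))"
      proof -
        have "A $$ (j, l) = A $$ (l, j)" if "l < n" for l
          using A ij(2) that by (metis carrier_matD index_transpose_mat(1))
        moreover have "q $ j = (\<Sum>l<n. A $$ (j, l) * x $ l)"
          using A(1) x ij(2) by (auto simp: scalar_prod_def atLeast0LessThan)
        ultimately show ?thesis by (simp add: mult.commute)
      qed
      moreover have "(F * A) $$ (i, j) = (\<Sum>l<n. F $$ (i, l) * A $$ (l, j))"
        using ij A(1) by (auto simp: scalar_prod_def atLeast0LessThan F_def)
      ultimately show "C $$ (i, j) = (F * A) $$ (i, j)"
        using ij by (auto simp: F_def C_def if_distrib[of "\<lambda>x. x * _"] cong: if_cong)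
    qed (use A in \<open>auto simp: F_def C_def\<close>)
    then have "W.rank C \<le> V.rank A"
      using rank_mult_le[OF A(1), of F "n + 1"] by (simp add: F_def)
    then show "mat_rank A = mat_rank M"
      using span_iff R A_le_C rM by simp
  qed
qed

lemma rank_append_vec_eq_iff:
  fixes A :: "real mat"
  assumes A: "A \<in> carrier_mat n n" and s: "s \<in> carrier_vec n"
  shows "mat_rank A = mat_rank (mat_of_cols n (cols A @ [s])) \<longleftrightarrow> (\<exists>x\<in>carrier_vec n. A *\<^sub>v x = s)"
proof -
  interpret V: vec_space "TYPE(real)" n .
  have M: "mat_of_cols n (cols A @ [s]) \<in> carrier_mat n (n + 1)" using A by auto
  have "set (cols A) \<subseteq> carrier_vec n" using cols_dim A by blast
  then have "cols (mat_of_cols n (cols A @ [s])) = cols A @ [s]"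
    using s by (intro cols_mat_of_cols) auto
  then have "set (cols (mat_of_cols n (cols A @ [s]))) = insert s (set (cols A))" by simp
  from V.rank_append_col_iff[OF A M this] V.col_space_eq[OF A] show ?thesis
    using A s by auto
qed

section \<open>Representing measures\<close>

lemma atomic_measure_exists:
  fixes c :: "real \<Rightarrow> real"
  assumes T: "finite T" and c: "\<And>t. t \<in> T \<Longrightarrow> 0 < c t"
  shows "\<exists>\<mu>. atomic_measure (card T) \<mu> \<and>
    (\<forall>n. integrable \<mu> (\<lambda>t. t ^ n) \<and> (\<integral>t. t ^ n \<partial>\<mu>) = (\<Sum>t\<in>T. c t * t ^ n))"
proof -
  define P where "P = point_measure T (\<lambda>t. ennreal (c t))"
  \<comment> \<open>A point measure lives on the power set of \<open>T\<close>; the identity pushes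
    it forward to the Borel sets of the line.\<close>
  define \<mu> where "\<mu> = distr P borel (\<lambda>x. x)"
  have meas: "(\<lambda>x. x) \<in> measurable P borel"
    by (simp add: P_def measurable_point_measure_eq1)
  have sets: "sets \<mu> = sets borel" by (simp add: \<mu>_def)
  have "emeasure \<mu> B = (\<Sum>t\<in>T. ennreal (c t) * emeasure (return borel t) B)" if B: "B \<in> sets borel" for B
  proof -
    have "emeasure \<mu> B = emeasure P (B \<inter> T)"
      using B meas by (simp add: \<mu>_def emeasure_distr P_def space_point_measure)
    also have "\<dots> = (\<Sum>t\<in>B \<inter> T. ennreal (c t))"
      using T by (simp add: P_def emeasure_point_measure_finite)
    also have "\<dots> = (\<Sum>t\<in>T. ennreal (c t) * emeasure (return borel t) B)"
      using T B by (intro sum.mono_neutral_cong_left) (auto simp: indicator_def)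
    finally show ?thesis .
  qed
  then have "atomic_measure (card T) \<mu>"
    unfolding atomic_measure_def using sets T c by blast
  moreover have "integrable \<mu> (\<lambda>t. t ^ n) \<and> (\<integral>t. t ^ n \<partial>\<mu>) = (\<Sum>t\<in>T. c t * t ^ n)" for n
  proof -
    have "integrable P (\<lambda>t. t ^ n)"
      unfolding P_def using T by (rule integrable_point_measure_finite)
    then have "integrable \<mu> (\<lambda>t. t ^ n)"
      unfolding \<mu>_def using meas by (simp add: integrable_distr_eq)
    moreover have "(\<integral>t. t ^ n \<partial>\<mu>) = (\<integral>t. t ^ n \<partial>P)"
      unfolding \<mu>_def using meas by (simp add: integral_distr)
    moreover have "(\<integral>t. t ^ n \<partial>P) = (\<Sum>t\<in>T. c t * t ^ n)"
      unfolding P_def using T c by (subst lebesgue_integral_point_measure_finite) (auto intro: less_imp_le)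
    ultimately show ?thesis by simp
  qed
  ultimately show ?thesis by blast
qed

lemma representing_measure_poly:
  assumes \<mu>: "representing_measure n \<gamma> \<mu>" and p: "degree p \<le> n"
  shows "integrable \<mu> (poly p)" "(\<integral>t. poly p t \<partial>\<mu>) = riesz \<gamma> p"
proof -
  have int: "integrable \<mu> (\<lambda>t. coeff p i * t ^ i)" if "i \<le> degree p" for i
    using \<mu> p that by (auto simp: representing_measure_def)
  have alt: "poly p = (\<lambda>t. \<Sum>i\<le>degree p. coeff p i * t ^ i)"
    by (rule ext) (rule poly_altdef)
  show "integrable \<mu> (poly p)" unfolding alt using int by (intro Bochner_Integration.integrable_sum) auto
  have "(\<integral>t. poly p t \<partial>\<mu>) = (\<Sum>i\<le>degree p. \<integral>t. coeff p i * t ^ i \<partial>\<mu>)"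
    unfolding alt using int by (intro Bochner_Integration.integral_sum) auto
  also have "\<dots> = riesz \<gamma> p"
    using \<mu> p by (auto simp: riesz_def representing_measure_def intro!: sum.cong)
  finally show "(\<integral>t. poly p t \<partial>\<mu>) = riesz \<gamma> p" .
qed

lemma representing_measure_riesz_nonneg:
  assumes "representing_measure (2 * k) \<gamma> \<mu>" "degree q \<le> k"
  shows "0 \<le> riesz \<gamma> (q * q)"
proof -
  have "degree (q * q) \<le> 2 * k" using assms(2) degree_mult_le[of q q] by simp
  from representing_measure_poly(2)[OF assms(1) this]
  have "riesz \<gamma> (q * q) = (\<integral>t. poly (q * q) t \<partial>\<mu>)" ..
  also have "\<dots> \<ge> 0" by (intro integral_nonneg_AE) auto
  finally show ?thesis .
qed

lemma representing_measure_null_AE: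
  assumes "representing_measure (2 * k) \<gamma> \<mu>" "degree q \<le> k" "riesz \<gamma> (q * q) = 0"
  shows "AE t in \<mu>. poly q t = 0"
proof -
  have deg: "degree (q * q) \<le> 2 * k" using assms(2) degree_mult_le[of q q] by simp
  have "(\<integral>t. poly (q * q) t \<partial>\<mu>) = 0"
    using representing_measure_poly(2)[OF assms(1) deg] assms(3) by simp
  then have "AE t in \<mu>. poly (q * q) t = 0"
    by (subst (asm) integral_nonneg_eq_0_iff_AE[OF representing_measure_poly(1)[OF assms(1) deg]]) auto
  then show ?thesis by auto
qed

text \<open>Almost everywhere f agrees with its remainder modulo p, so \<Lambda>(f^2) = \<Lambda>(f
  (f mod p)), a pairing with a polynomial of degree below that of p. This turns a bound on the
  support into nullity of residues.\<close>

lemma representing_measure_orthogonal_null: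
  assumes \<mu>: "representing_measure (2 * k) \<gamma> \<mu>" and p: "p \<noteq> 0" "AE t in \<mu>. poly p t = 0"
    and f: "degree f \<le> k" and orth: "\<And>g. degree g < degree p \<Longrightarrow> riesz \<gamma> (f * g) = 0"
  shows "riesz \<gamma> (f * f) = 0"
proof -
  let ?h = "f mod p"
  have "degree ?h \<le> degree f"
  proof (cases "degree f < degree p")
    case False
    then show ?thesis using degree_mod_less[OF p(1), of f] by auto
  qed (simp add: mod_poly_less)
  then have deg: "degree (f * f) \<le> 2 * k" "degree (f * ?h) \<le> 2 * k"
    using f degree_mult_le[of f f] degree_mult_le[of f ?h] by simp_all
  have "poly f t = poly (f div p) t * poly p t + poly ?h t" for t
    by (metis div_mult_mod_eq poly_add poly_mult)
  then have AE: "AE t in \<mu>. poly (f * f) t = poly (f * ?h) t"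
    using p(2) by (auto elim!: eventually_mono)
  have "(\<integral>t. poly (f * f) t \<partial>\<mu>) = (\<integral>t. poly (f * ?h) t \<partial>\<mu>)"
    by (rule integral_cong_AE[OF borel_measurable_integrable borel_measurable_integrable AE])
      (rule representing_measure_poly(1)[OF \<mu>], fact deg)+
  then have "riesz \<gamma> (f * f) = riesz \<gamma> (f * ?h)"
    by (simp only: representing_measure_poly(2)[OF \<mu> deg(1)] representing_measure_poly(2)[OF \<mu> deg(2)])
  \<comment> \<open>A zero remainder is treated separately: for constant p its degree 0 is not below
    that of p.\<close>
  also have "\<dots> = 0"
    using orth[of ?h] degree_mod_less[OF p(1), of f] by (cases "?h = 0") auto
  finally show ?thesis .
qed

lemma atomic_measure_AE_poly:
  assumes "atomic_measure m \<mu>"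
  obtains p where "p \<noteq> 0" "degree p = m" "AE t in \<mu>. poly p t = 0"
proof -
  obtain T c where sets: "sets \<mu> = sets borel" and T: "finite T" "card T = m"
    and \<mu>: "\<And>B. B \<in> sets borel \<Longrightarrow> emeasure \<mu> B = (\<Sum>t\<in>T. ennreal (c t) * emeasure (return borel t) B)"
    using assms unfolding atomic_measure_def by blast
  define p where "p = (\<Prod>t\<in>T. [:- t, 1:])"
  have "p \<noteq> 0" using T(1) by (simp add: p_def)
  moreover have "degree p = m"
    unfolding p_def using T by (subst degree_prod_eq_sum_degree) auto
  moreover have "AE t in \<mu>. poly p t = 0"
  proof (rule AE_I')
    have borel: "- T \<in> sets borel" using T(1) by (intro borel_comp borel_closed finite_imp_closed)
    have "emeasure \<mu> (- T) = 0" using T(1) borel by (simp add: \<mu> indicator_def)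
    then show "- T \<in> null_sets \<mu>" using borel sets by (simp add: null_sets_def)
    show "{t \<in> space \<mu>. poly p t \<noteq> 0} \<subseteq> - T"
      using T(1) by (auto simp: p_def poly_prod)
  qed
  ultimately show ?thesis using that by blast
qed

lemma partial_seq_eq_Some:
  assumes "partial_seq k \<beta> i \<noteq> None"
  shows "partial_seq k \<beta> i = Some (completion k \<beta> x y i)"
  using assms by (auto simp: partial_seq_def completion_def split: if_splits)

text \<open>A fully specified principal submatrix is also one of the completed Hankel matrix. A
  vector v on I becomes the polynomial with coefficient v_i at the i-th smallest exponent in I, and
  its quadratic form is \<Lambda>(q^2).\<close>

lemma representing_measure_partially_psd:
  assumes \<mu>: "representing_measure (2 * k) (completion k \<beta> x y) \<mu>"
  shows "partially_psd (hankel k (partial_seq k \<beta>))"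
  unfolding partially_psd_def
proof (intro conjI allI impI)
  show "square_mat (hankel k (partial_seq k \<beta>))" by (simp add: square_mat.simps)
next
  fix I assume I: "I \<subseteq> {0..<dim_row (hankel k (partial_seq k \<beta>))}"
    and spec: "\<forall>i\<in>I. \<forall>j\<in>I. hankel k (partial_seq k \<beta>) $$ (i, j) \<noteq> None"
  define \<gamma> where "\<gamma> = completion k \<beta> x y"
  define n where "n = card I"
  define N where "N = map_mat the (submatrix (hankel k (partial_seq k \<beta>)) I I)"
  have card: "card {i. i < Suc k \<and> i \<in> I} = n"
    using I unfolding n_def by (intro arg_cong[where f = card]) auto
  have pick: "pick I i \<in> I" "pick I i \<le> k" if "i < n" for i
  proof -
    show "pick I i \<in> I" using that unfolding n_def by (intro pick_in_set_le)
    then show "pick I i \<le> k" using I by auto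
  qed
  have N: "N \<in> carrier_mat n n"
    unfolding N_def by (auto simp: dim_submatrix card)
  have N_entry: "N $$ (i, j) = \<gamma> (pick I i + pick I j)" if "i < n" "j < n" for i j
  proof -
    have "N $$ (i, j) = the (hankel k (partial_seq k \<beta>) $$ (pick I i, pick I j))"
      unfolding N_def using that card by (simp add: submatrix_index dim_submatrix)
    moreover have "hankel k (partial_seq k \<beta>) $$ (pick I i, pick I j) \<noteq> None"
      using spec pick that by blast
    ultimately show ?thesis
      using pick that partial_seq_eq_Some[of k \<beta> "pick I i + pick I j" x y] by (auto simp: \<gamma>_def)
  qed
  have "0 \<le> v \<bullet> (N *\<^sub>v v)" if v: "v \<in> carrier_vec n" for v
  proof -
    define q where "q = (\<Sum>i<n. monom (v $ i) (pick I i))"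
    have "degree q \<le> k"
      unfolding q_def using pick
      by (intro degree_sum_le) (auto intro: order.trans[OF degree_monom_le])
    then have "0 \<le> riesz \<gamma> (q * q)"
      using representing_measure_riesz_nonneg \<mu> unfolding \<gamma>_def by blast
    also have "q * q = (\<Sum>i<n. \<Sum>j<n. monom (v $ i * v $ j) (pick I i + pick I j))"
      unfolding q_def by (simp add: sum_product mult_monom)
    also have "riesz \<gamma> \<dots> = (\<Sum>i<n. \<Sum>j<n. v $ i * v $ j * \<gamma> (pick I i + pick I j))"
      by (simp add: riesz_sum)
    also have "\<dots> = v \<bullet> (N *\<^sub>v v)"
      using v N N_entry
      by (auto simp: scalar_prod_def atLeast0LessThan sum_distrib_left mult_ac intro!: sum.cong)
    finally show ?thesis .
  qed
  moreover have "N\<^sup>T = N"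
    using N N_entry by (intro eq_matI) (auto simp: add.commute)
  ultimately show "psd_mat (map_mat the (submatrix (hankel k (partial_seq k \<beta>)) I I))"
    using N unfolding psd_mat_def N_def[symmetric] by (auto simp: square_mat.simps)
qed

lemma has_atomic_representing_measureI:
  assumes T: "finite T" and c: "\<And>t. t \<in> T \<Longrightarrow> 0 < c t"
    and moments: "\<And>n. n \<le> 2 * k \<Longrightarrow> completion k \<beta> x y n = (\<Sum>t\<in>T. c t * t ^ n)"
  shows "has_atomic_representing_measure (card T) k \<beta>"
proof -
  obtain \<mu> where \<mu>: "atomic_measure (card T) \<mu>"
    "\<And>n. integrable \<mu> (\<lambda>t. t ^ n) \<and> (\<integral>t. t ^ n \<partial>\<mu>) = (\<Sum>t\<in>T. c t * t ^ n)"
    using atomic_measure_exists[of T c] T c by blast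
  moreover have "representing_measure (2 * k) (completion k \<beta> x y) \<mu>"
    unfolding representing_measure_def using \<mu> moments by (auto simp: atomic_measure_def)
  ultimately show ?thesis unfolding has_atomic_representing_measure_def by blast
qed

section \<open>Sequences with a gap\<close>

lemma riesz_square_add_smult:
  "riesz \<gamma> ((smult d f + p) * (smult d f + p)) = d * d * riesz \<gamma> (f * f) + 2 * d * riesz \<gamma> (f * p) + riesz \<gamma> (p * p)"
proof -
  have "(smult d f + p) * (smult d f + p) = smult (d * d) (f * f) + smult d (f * p) + smult d (f * p) + p * p"
    by (simp add: algebra_simps)
  then show ?thesis by (simp only: riesz_add riesz_smult)
qed

text \<open>With \<open>k = m + 3\<close>, the vectors \<open>a\<close>, \<open>b\<close>, \<open>c\<close> solve \<open>A a = s\<close> (\<open>A\<close> the Hankel matrix of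
  \<open>\<beta>\<^sub>0, \<dots>, \<beta>\<^bsub>2k-4\<^esub>\<close>), \<open>A' b = w\<close> and \<open>A' c = u\<close> (\<open>A'\<close> that of \<open>\<beta>\<^sub>0, \<dots>, \<beta>\<^bsub>2k-6\<^esub>\<close>).\<close>

locale gapped_hankel =
  fixes m :: nat and \<beta> :: "nat \<Rightarrow> real" and a b c :: "real vec"
  assumes carrier: "a \<in> carrier_vec (m + 2)" "b \<in> carrier_vec (m + 1)" "c \<in> carrier_vec (m + 1)"
    and a_eq: "\<And>j. j \<le> m + 1 \<Longrightarrow> (\<Sum>i<m + 2. a $ i * \<beta> (i + j)) = \<beta> (m + 2 + j)"
    and b_eq: "\<And>j. j \<le> m \<Longrightarrow> (\<Sum>i<m + 1. b $ i * \<beta> (i + j)) = \<beta> (m + 1 + j)"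
    and c_eq: "\<And>j. j \<le> m \<Longrightarrow> (\<Sum>i<m + 1. c $ i * \<beta> (i + j)) = \<beta> (m + 3 + j)"
begin

definition "S = monom 1 (m + 2) - vpoly a"
definition "W = monom 1 (m + 1) - vpoly b"
definition "U = monom 1 (m + 3) - vpoly c"
text \<open>In terms of the solutions, \<open>L\<close> is s . a and \<open>R\<close> is u . b,
  while \<alpha> and \<delta> are the Schur complements of the bordered matrices. All four avoid the
  entries 2 m + 4 and 2 m + 5 of the gap, so they are the same for every completion.\<close>

definition "L = (\<Sum>i<m + 2. a $ i * \<beta> (i + (m + 2)))"
definition "R = (\<Sum>i<m + 1. b $ i * \<beta> (i + (m + 3)))"
definition "\<alpha> = \<beta> (2 * m + 2) - (\<Sum>i<m + 1. b $ i * \<beta> (i + (m + 1)))"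
definition "\<delta> = \<beta> (2 * m + 6) - (\<Sum>i<m + 1. c $ i * \<beta> (i + (m + 3)))"

text \<open>Of the relevant entries only 2 m + 4 and 2 m + 5 are free. As \<open>\<beta>\<close>
  extends itself, identities for completions also hold for the original sequence.\<close>

definition extends :: "(nat \<Rightarrow> real) \<Rightarrow> bool" where
  "extends \<gamma> \<longleftrightarrow> (\<forall>i\<le>2 * m + 3. \<gamma> i = \<beta> i) \<and> \<gamma> (2 * m + 6) = \<beta> (2 * m + 6)"

lemma extends_le: "extends \<gamma> \<Longrightarrow> i \<le> 2 * m + 3 \<Longrightarrow> \<gamma> i = \<beta> i"
  by (simp add: extends_def)

lemma extends_last: "extends \<gamma> \<Longrightarrow> \<gamma> (2 * m + 6) = \<beta> (2 * m + 6)"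
  by (simp add: extends_def)

lemma extends_completion: "extends (completion (m + 3) \<beta> x y)"
  by (auto simp: extends_def completion_def)

lemma monic_vpoly:
  assumes "v \<in> carrier_vec n" "n \<le> d"
  shows "degree (monom 1 d - vpoly v) = d" "coeff (monom 1 d - vpoly v) d = 1"
proof -
  show 1: "coeff (monom 1 d - vpoly v) d = 1"
    using assms by (simp add: coeff_vpoly)
  have "degree (monom 1 d - vpoly v) \<le> d"
    using assms by (intro degree_le) (auto simp: coeff_vpoly)
  with 1 show "degree (monom 1 d - vpoly v) = d"
    by (metis le_antisym le_degree zero_neq_one)
qed

lemma monic:
  "degree S = m + 2" "coeff S (m + 2) = 1"
  "degree W = m + 1" "coeff W (m + 1) = 1"
  "degree U = m + 3" "coeff U (m + 3) = 1"
  unfolding S_def W_def U_def using monic_vpoly carrier by auto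

lemma nonzero: "S \<noteq> 0" "W \<noteq> 0" "U \<noteq> 0"
  using monic by auto

lemma degree_vpoly_le: "degree (vpoly a) \<le> m + 1" "degree (vpoly b) \<le> m" "degree (vpoly c) \<le> m"
  using carrier by (auto intro: degree_vpoly)

lemma riesz_residue:
  assumes "v \<in> carrier_vec n"
  shows "riesz \<gamma> ((monom 1 d - vpoly v) * monom 1 j)
    = \<gamma> (d + j) - (\<Sum>i<n. v $ i * \<gamma> (i + j))"
  unfolding left_diff_distrib riesz_diff riesz_vpoly_mult[OF assms] by (simp add: mult_monom)

lemma S_orth:
  assumes "extends \<gamma>" "degree q \<le> m + 1"
  shows "riesz \<gamma> (S * q) = 0"
proof (rule riesz_mult_eq_0[OF _ assms(2)])
  fix j assume "j \<le> m + 1"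
  then show "riesz \<gamma> (S * monom 1 j) = 0"
    unfolding S_def riesz_residue[OF carrier(1)] using a_eq[of j] assms(1) by (simp add: extends_le)
qed

lemma W_orth:
  assumes "extends \<gamma>" "degree q \<le> m"
  shows "riesz \<gamma> (W * q) = 0"
proof (rule riesz_mult_eq_0[OF _ assms(2)])
  fix j assume "j \<le> m"
  then show "riesz \<gamma> (W * monom 1 j) = 0"
    unfolding W_def riesz_residue[OF carrier(2)] using b_eq[of j] assms(1) by (simp add: extends_le)
qed

lemma U_orth:
  assumes "extends \<gamma>" "degree q \<le> m"
  shows "riesz \<gamma> (U * q) = 0"
proof (rule riesz_mult_eq_0[OF _ assms(2)])
  fix j assume "j \<le> m"
  then show "riesz \<gamma> (U * monom 1 j) = 0"
    unfolding U_def riesz_residue[OF carrier(3)] using c_eq[of j] assms(1) by (simp add: extends_le)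
qed

lemma index:
  "m + 2 + (m + 2) = 2 * m + 4" "m + 1 + (m + 1) = 2 * m + 2" "m + 3 + (m + 3) = 2 * m + 6"
  "m + 1 + (m + 3) = 2 * m + 4" "m + 3 + (m + 2) = 2 * m + 5" "m + 1 + (m + 2) = 2 * m + 3"
  by simp_all

text \<open>\<open>S\<close> is orthogonal to its own lower part, so only the pairing with its
  leading monomial survives; likewise for the other three products.\<close>

lemma riesz_SS:
  assumes "extends \<gamma>"
  shows "riesz \<gamma> (S * S) = \<gamma> (2 * m + 4) - L"
proof -
  have "riesz \<gamma> (S * S) = riesz \<gamma> (S * monom 1 (m + 2)) - riesz \<gamma> (S * vpoly a)"
    unfolding S_def[THEN arg_cong, of "\<lambda>q. S * q"] by (simp only: right_diff_distrib riesz_diff)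
  also have "riesz \<gamma> (S * vpoly a) = 0" using assms degree_vpoly_le(1) by (rule S_orth)
  also have "riesz \<gamma> (S * monom 1 (m + 2)) = \<gamma> (2 * m + 4) - L"
    unfolding S_def riesz_residue[OF carrier(1)] L_def index(1)
    using assms by (simp add: extends_le)
  finally show ?thesis by simp
qed

lemma riesz_WW:
  assumes "extends \<gamma>"
  shows "riesz \<gamma> (W * W) = \<alpha>"
proof -
  have "riesz \<gamma> (W * W) = riesz \<gamma> (W * monom 1 (m + 1)) - riesz \<gamma> (W * vpoly b)"
    unfolding W_def[THEN arg_cong, of "\<lambda>q. W * q"] by (simp only: right_diff_distrib riesz_diff)
  also have "riesz \<gamma> (W * vpoly b) = 0" using assms degree_vpoly_le(2) by (rule W_orth)
  also have "riesz \<gamma> (W * monom 1 (m + 1)) = \<alpha>"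
    unfolding W_def riesz_residue[OF carrier(2)] \<alpha>_def index(2)
    using assms by (simp add: extends_le)
  finally show ?thesis by simp
qed

lemma riesz_UU:
  assumes "extends \<gamma>"
  shows "riesz \<gamma> (U * U) = \<delta>"
proof -
  have "riesz \<gamma> (U * U) = riesz \<gamma> (U * monom 1 (m + 3)) - riesz \<gamma> (U * vpoly c)"
    unfolding U_def[THEN arg_cong, of "\<lambda>q. U * q"] by (simp only: right_diff_distrib riesz_diff)
  also have "riesz \<gamma> (U * vpoly c) = 0" using assms degree_vpoly_le(3) by (rule U_orth)
  also have "riesz \<gamma> (U * monom 1 (m + 3)) = \<delta>"
    unfolding U_def riesz_residue[OF carrier(3)] \<delta>_def index(3)
    using assms extends_last[OF assms] by (simp add: extends_le)
  finally show ?thesis by simp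
qed

lemma riesz_WU:
  assumes "extends \<gamma>"
  shows "riesz \<gamma> (W * U) = \<gamma> (2 * m + 4) - R"
proof -
  have "riesz \<gamma> (W * U) = riesz \<gamma> (W * monom 1 (m + 3)) - riesz \<gamma> (W * vpoly c)"
    unfolding U_def by (simp only: right_diff_distrib riesz_diff)
  also have "riesz \<gamma> (W * vpoly c) = 0" using assms degree_vpoly_le(3) by (rule W_orth)
  also have "riesz \<gamma> (W * monom 1 (m + 3)) = \<gamma> (2 * m + 4) - R"
    unfolding W_def riesz_residue[OF carrier(2)] R_def index(4)
    using assms by (simp add: extends_le)
  finally show ?thesis by simp
qed

text \<open>Subtracting the multiple of \<open>W\<close> below makes \<open>U\<close> orthogonal to \<open>W\<close> as well
  (for \<open>\<alpha> = 0\<close> nothing is subtracted, as division by 0 yields 0).\<close>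

definition Q :: "real \<Rightarrow> real poly" where
  "Q y = U - smult ((y - R) / \<alpha>) W"

lemma monic_Q: "degree (Q y) = m + 3" "coeff (Q y) (m + 3) = 1"
proof -
  have "degree (smult ((y - R) / \<alpha>) W) < degree U"
    using monic degree_smult_le[of "(y - R) / \<alpha>" W] by simp
  then have "degree (U + - smult ((y - R) / \<alpha>) W) = degree U"
    by (intro degree_add_eq_left) simp
  then show "degree (Q y) = m + 3" using monic by (simp add: Q_def)
  show "coeff (Q y) (m + 3) = 1"
    using monic by (simp add: Q_def coeff_eq_0)
qed

text \<open>Orthogonality reaches one degree further than for \<open>U\<close> and \<open>W\<close>:
  \<open>W\<close> itself represents degree m + 1, and the coefficient in \<open>Q y\<close> is
  chosen to cancel \<Lambda>(W U). For \<alpha> = 0 nothing can cancel it, so y = R is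
  required.\<close>

lemma Q_orth:
  assumes ext: "extends \<gamma>" and y: "\<gamma> (2 * m + 4) = y" and 0: "\<alpha> = 0 \<Longrightarrow> y = R"
    and q: "degree q \<le> m + 1"
  shows "riesz \<gamma> (Q y * q) = 0"
proof -
  have low: "riesz \<gamma> (Q y * g) = 0" if "degree g \<le> m" for g
    unfolding Q_def left_diff_distrib riesz_diff mult_smult_left riesz_smult
    using U_orth[OF ext that] W_orth[OF ext that] by simp
  have eq: "Q y * W = W * U - smult ((y - R) / \<alpha>) (W * W)"
    by (simp add: Q_def algebra_simps)
  have QW: "riesz \<gamma> (Q y * W) = 0"
    unfolding eq riesz_diff riesz_smult riesz_WU[OF ext] riesz_WW[OF ext] y
    using 0 by (cases "\<alpha> = 0") simp_all
  let ?h = "q - smult (coeff q (m + 1)) W"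
  have "degree ?h \<le> m" using degree_diff_monic_le[of q m W] q monic by simp
  moreover have "Q y * q = Q y * ?h + smult (coeff q (m + 1)) (Q y * W)"
    by (simp add: algebra_simps)
  ultimately show ?thesis
    using low QW by (simp only: riesz_add riesz_smult mult_zero_right add_0)
qed

lemma riesz_QU:
  assumes ext: "extends \<gamma>" and y: "\<gamma> (2 * m + 4) = y"
  shows "riesz \<gamma> (Q y * U) = \<delta> - (y - R)\<^sup>2 / \<alpha>"
proof -
  have "Q y * U = U * U - smult ((y - R) / \<alpha>) (W * U)"
    by (simp add: Q_def algebra_simps)
  then have "riesz \<gamma> (Q y * U) = \<delta> - (y - R) / \<alpha> * (y - R)"
    by (simp only: riesz_diff riesz_smult riesz_WU[OF ext] riesz_UU[OF ext] y)
  then show ?thesis by (simp add: power2_eq_square)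
qed

lemma riesz_QQ:
  assumes ext: "extends \<gamma>" and y: "\<gamma> (2 * m + 4) = y" and 0: "\<alpha> = 0 \<Longrightarrow> y = R"
  shows "riesz \<gamma> (Q y * Q y) = \<delta> - (y - R)\<^sup>2 / \<alpha>"
proof -
  have "Q y * Q y = Q y * U - smult ((y - R) / \<alpha>) (Q y * W)"
    by (subst (2) Q_def) (simp add: right_diff_distrib)
  moreover have "riesz \<gamma> (Q y * W) = 0"
    by (rule Q_orth[OF ext y 0]) (simp_all only: monic order.refl)
  ultimately show ?thesis
    using riesz_QU[OF ext y] by (simp only: riesz_diff riesz_smult mult_zero_right diff_zero)
qed

lemma flat_completion:
  assumes psd: "psd_mat (hankel (m + 1) \<beta>)" and y: "(y - R)\<^sup>2 = \<alpha> * \<delta>" "L \<le> y"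
    and 0: "\<alpha> = 0 \<Longrightarrow> \<delta> = 0"
  obtains x where
    "\<And>f. degree f \<le> m + 3 \<Longrightarrow> riesz (completion (m + 3) \<beta> x y) (Q y * f) = 0"
    "\<And>f. degree f \<le> m + 3 \<Longrightarrow> 0 \<le> riesz (completion (m + 3) \<beta> x y) (f * f)"
proof -
  have y0: "y = R" if "\<alpha> = 0" using y(1) that by simp
  \<comment> \<open>The entry x occurs in \<Lambda>(Q t^(m+2)) with coefficient 1; this value makes
    that pairing vanish.\<close>
  define x where "x = (\<Sum>i<m + 1. c $ i * \<beta> (i + (m + 2)))
    + (y - R) / \<alpha> * (\<beta> (2 * m + 3) - (\<Sum>i<m + 1. b $ i * \<beta> (i + (m + 2))))"
  define \<gamma> where "\<gamma> = completion (m + 3) \<beta> x y"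
  have ext: "extends \<gamma>" unfolding \<gamma>_def by (rule extends_completion)
  have \<gamma>y: "\<gamma> (2 * m + 4) = y" and \<gamma>x: "\<gamma> (2 * m + 5) = x" by (simp_all add: \<gamma>_def completion_def)
  note orth = Q_orth[OF ext \<gamma>y y0]
  have "riesz \<gamma> (Q y * monom 1 (m + 2)) =
      riesz \<gamma> (U * monom 1 (m + 2)) - (y - R) / \<alpha> * riesz \<gamma> (W * monom 1 (m + 2))"
    unfolding Q_def left_diff_distrib riesz_diff mult_smult_left riesz_smult by simp
  also have "riesz \<gamma> (U * monom 1 (m + 2)) = x - (\<Sum>i<m + 1. c $ i * \<beta> (i + (m + 2)))"
    unfolding U_def riesz_residue[OF carrier(3)] index(5) using ext \<gamma>x by (simp add: extends_le)
  also have "riesz \<gamma> (W * monom 1 (m + 2)) =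
      \<beta> (2 * m + 3) - (\<Sum>i<m + 1. b $ i * \<beta> (i + (m + 2)))"
    unfolding W_def riesz_residue[OF carrier(2)] index(6) using ext by (simp add: extends_le)
  finally have Qx: "riesz \<gamma> (Q y * monom 1 (m + 2)) = 0" by (simp add: x_def)
  \<comment> \<open>For \<alpha> = 0 the quotient is 0 by convention, which is why \<delta> = 0 is
    required in that case.\<close>
  have "(y - R)\<^sup>2 / \<alpha> = \<delta>" using y(1) 0 by (cases "\<alpha> = 0") auto
  then have QU: "riesz \<gamma> (Q y * U) = 0"
    using riesz_QU[OF ext \<gamma>y] by simp
  have Qt: "riesz \<gamma> (Q y * monom 1 j) = 0" if "j \<le> m + 2" for j
  proof (cases "j = m + 2")
    case False
    then show ?thesis using that by (intro orth) (auto simp: degree_monom_eq)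
  qed (use Qx in simp)
  have Q_low: "riesz \<gamma> (Q y * f) = 0" if "degree f \<le> m + 2" for f
    using Qt that by (rule riesz_mult_eq_0)
  have Q_null: "riesz \<gamma> (Q y * f) = 0" if f: "degree f \<le> m + 3" for f
  proof -
    let ?h = "f - smult (coeff f (m + 3)) U"
    have "degree ?h \<le> m + 2" using degree_diff_monic_le[of f "m + 2" U] f monic by (simp add: numeral_3_eq_3)
    moreover have "Q y * f = Q y * ?h + smult (coeff f (m + 3)) (Q y * U)"
      by (simp add: algebra_simps)
    ultimately show ?thesis
      using Q_low QU by (simp only: riesz_add riesz_smult mult_zero_right add_0)
  qed
  have "0 \<le> riesz \<gamma> (f * f)" if f: "degree f \<le> m + 3" for f
  proof -
    \<comment> \<open>The decomposition f = e Q + d S + h diagonalises the form: \<Lambda>(f^2) =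
      d^2 (y - L) + \<Lambda>(h^2), with the last term below the gap.\<close>
    define e where "e = coeff f (m + 3)"
    define g where "g = f - smult e (Q y)"
    define d where "d = coeff g (m + 2)"
    define h where "h = g - smult d S"
    have g: "degree g \<le> m + 2"
      using degree_diff_monic_le[of f "m + 2" "Q y"] f monic_Q unfolding g_def e_def by (simp add: numeral_3_eq_3)
    have h: "degree h \<le> m + 1"
      using degree_diff_monic_le[of g "m + 1" S] g monic unfolding h_def d_def by simp
    have "f = smult e (Q y) + g" by (simp add: g_def)
    then have "riesz \<gamma> (f * f) = riesz \<gamma> (g * g)"
      using riesz_square_add_smult[of \<gamma> e "Q y" g] Q_null[of g] Q_null[of "Q y"] g monic_Q by simp
    also have "g = smult d S + h" by (simp add: h_def)
    also have "riesz \<gamma> ((smult d S + h) * (smult d S + h)) = d * d * (y - L) + riesz \<gamma> (h * h)"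
      using riesz_square_add_smult[of \<gamma> d S h] S_orth[OF ext h] riesz_SS[OF ext] \<gamma>y by simp
    also have "riesz \<gamma> (h * h) = riesz \<beta> (h * h)"
      using h degree_mult_le[of h h] ext by (intro riesz_cong extends_le) auto
    finally show ?thesis using psd h y(2) by (simp add: psd_hankel_iff)
  qed
  then show ?thesis using that Q_null unfolding \<gamma>_def by blast
qed

text \<open>The atom count is the least degree of a null polynomial of the completion. In the
  definite case the sequence has rank k - 1, so the roots of \<open>S\<close> and \<open>Q y\<close>
  supply r and r + 1 atoms. In the singular case a null polynomial of degree r exists below the gap,
  and y does not influence the count.\<close>

lemma has_atomic_representing_measure_gap:
  assumes psd: "psd_mat (hankel (m + 1) \<beta>)" and y: "(y - R)\<^sup>2 = \<alpha> * \<delta>" "L \<le> y"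
    and 0: "\<alpha> = 0 \<Longrightarrow> \<delta> = 0"
  defines "r \<equiv> seq_rank (m + 1) \<beta>"
  shows "has_atomic_representing_measure
    (if pd_mat (hankel (m + 1) \<beta>) \<and> L < y then r + 1 else r) (m + 3) \<beta>"
proof -
  obtain x where x:
    "\<And>f. degree f \<le> m + 3 \<Longrightarrow> riesz (completion (m + 3) \<beta> x y) (Q y * f) = 0"
    "\<And>f. degree f \<le> m + 3 \<Longrightarrow> 0 \<le> riesz (completion (m + 3) \<beta> x y) (f * f)"
    using flat_completion[OF psd y 0] by blast
  define \<gamma> where "\<gamma> = completion (m + 3) \<beta> x y"
  note x = x[folded \<gamma>_def]
  have ext: "extends \<gamma>" unfolding \<gamma>_def by (rule extends_completion)
  have \<gamma>y: "\<gamma> (2 * m + 4) = y" by (simp add: \<gamma>_def completion_def)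
  have \<gamma>\<beta>: "riesz \<gamma> (q * q) = riesz \<beta> (q * q)" if "degree q \<le> m + 1" for q
    using that degree_mult_le[of q q] ext by (intro riesz_cong extends_le) auto
  have QQ: "riesz \<gamma> (Q y * Q y) = 0" using x(1) monic_Q by simp
  have atomic: "has_atomic_representing_measure d (m + 3) \<beta>"
    if p: "degree p = d" "coeff p d = 1" "d \<le> m + 3" "riesz \<gamma> (p * p) = 0"
      "\<And>q. q \<noteq> 0 \<Longrightarrow> degree q < d \<Longrightarrow> 0 < riesz \<gamma> (q * q)" for p d
  proof -
    obtain T c where T: "finite T" "card T = d" "\<forall>t\<in>T. 0 < c t"
      "\<forall>n\<le>2 * (m + 3). \<gamma> n = (\<Sum>t\<in>T. c t * t ^ n)"
      using flat_functional_quadrature[OF x(2) monic_Q QQ _ p] by auto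
    then show ?thesis
      using has_atomic_representing_measureI[of T c "m + 3" \<beta> x y] unfolding \<gamma>_def by auto
  qed
  show ?thesis
  proof (cases "pd_mat (hankel (m + 1) \<beta>)")
    case True
    have r: "r = m + 2" unfolding r_def using seq_rank_pd[OF True] by simp
    have pos: "0 < riesz \<gamma> (q * q)" if "q \<noteq> 0" "degree q \<le> m + 1" for q
      using True that \<gamma>\<beta> by (simp add: pd_hankel_iff)
    show ?thesis
    proof (cases "L < y")
      case Ly: True
      have "has_atomic_representing_measure (m + 3) (m + 3) \<beta>"
      proof (rule atomic[OF monic_Q _ QQ])
        fix q :: "real poly" assume q: "q \<noteq> 0" "degree q < m + 3"
        define d where "d = coeff q (m + 2)"
        define h where "h = q - smult d S"
        have h: "degree h \<le> m + 1"
          using degree_diff_monic_le[of q "m + 1" S] q monic unfolding h_def d_def by simp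
        have qh: "q = smult d S + h" by (simp add: h_def)
        have *: "riesz \<gamma> (q * q) = d * d * (y - L) + riesz \<gamma> (h * h)"
          using riesz_square_add_smult[of \<gamma> d S h] S_orth[OF ext h] riesz_SS[OF ext] \<gamma>y qh
          by (simp add: mult.commute)
        show "0 < riesz \<gamma> (q * q)"
        proof (cases "h = 0")
          case True
          then have "d \<noteq> 0" using q(1) qh by auto
          then have "0 < d * d * (y - L)" using Ly by (metis mult_pos_pos not_square_less_zero
                diff_gt_0_iff_gt linorder_neqE_linordered_idom mult_eq_0_iff)
          then show ?thesis using * True by simp
        next
          case False
          then have "0 < riesz \<gamma> (h * h)" using pos h by blast
          then show ?thesis using * Ly by (simp add: add_nonneg_pos)
        qed
      qed simp
      then show ?thesis using True Ly r by (simp add: numeral_3_eq_3)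
    next
      case False
      then have SS: "riesz \<gamma> (S * S) = 0" using riesz_SS[OF ext] \<gamma>y y(2) by simp
      have "has_atomic_representing_measure (m + 2) (m + 3) \<beta>"
        by (rule atomic[OF monic(1,2) _ SS]) (use pos in auto)
      then show ?thesis using False r by simp
    qed
  next
    case False
    obtain p where p: "degree p = r" "coeff p r = 1" "r \<le> m + 1" "riesz \<beta> (p * p) = 0"
        "\<And>q. q \<noteq> 0 \<Longrightarrow> degree q < r \<Longrightarrow> 0 < riesz \<beta> (q * q)"
      using seq_rank_psd_singular[OF psd False] unfolding r_def by blast
    have pp: "riesz \<gamma> (p * p) = 0" using \<gamma>\<beta>[of p] p(1,3,4) by simp
    have "has_atomic_representing_measure r (m + 3) \<beta>"
      by (rule atomic[OF p(1,2) _ pp]) (use p(3,5) \<gamma>\<beta> in auto)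
    then show ?thesis using False by simp
  qed
qed

section \<open>Constraints imposed on the gap by a measure\<close>

context
  fixes \<gamma> :: "nat \<Rightarrow> real" and \<mu> :: "real measure"
  assumes ext: "extends \<gamma>" and \<mu>: "representing_measure (2 * (m + 3)) \<gamma> \<mu>"
begin

lemmas nonneg = representing_measure_riesz_nonneg[OF \<mu>]

lemma gap_lower_bound: "L \<le> \<gamma> (2 * m + 4)"
  using nonneg[of S] riesz_SS[OF ext] monic by simp

lemma gap_Schur_nonneg: "0 \<le> \<alpha>" "0 \<le> \<delta>"
  using nonneg[of W] riesz_WW[OF ext] nonneg[of U] riesz_UU[OF ext] monic by auto

lemma gap_Schur_0: "\<alpha> = 0 \<Longrightarrow> \<gamma> (2 * m + 4) = R"
proof -
  assume "\<alpha> = 0"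
  then have "riesz \<gamma> (W * U) = 0"
    using riesz_null[of "m + 3" \<gamma> W U, OF nonneg] riesz_WW[OF ext] monic by simp
  then show ?thesis using riesz_WU[OF ext] by simp
qed

text \<open>For \<alpha> \<noteq> 0 this is \<Lambda>(Q^2) \<ge> 0 with denominators cleared; for
  \<alpha> = 0 the null polynomial \<open>W\<close> makes the left side 0.\<close>

lemma gap_Cauchy_Schwarz: "(\<gamma> (2 * m + 4) - R)\<^sup>2 \<le> \<alpha> * \<delta>"
proof (cases "\<alpha> = 0")
  case False
  have "0 \<le> riesz \<gamma> (Q (\<gamma> (2 * m + 4)) * Q (\<gamma> (2 * m + 4)))"
    by (rule nonneg) (simp add: monic_Q)
  then have "(\<gamma> (2 * m + 4) - R)\<^sup>2 / \<alpha> \<le> \<delta>"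
    using riesz_QQ[OF ext refl gap_Schur_0] by simp
  then show ?thesis using False gap_Schur_nonneg(1) by (simp add: divide_le_eq mult.commute)
qed (use gap_Schur_0 in simp)

text \<open>Remainders modulo p have degree at most m, where all three residues are orthogonal, so
  all three are null.\<close>

lemma singular_gap:
  assumes p: "p \<noteq> 0" "degree p \<le> m + 1" "AE t in \<mu>. poly p t = 0"
  shows "\<alpha> = 0" "\<delta> = 0" "\<gamma> (2 * m + 4) = L"
proof -
  note null = representing_measure_orthogonal_null[OF \<mu> p(1,3)]
  have "riesz \<gamma> (W * W) = 0" by (rule null) (use monic W_orth[OF ext] p(2) in auto)
  then show "\<alpha> = 0" using riesz_WW[OF ext] by simp
  have "riesz \<gamma> (U * U) = 0" by (rule null) (use monic U_orth[OF ext] p(2) in auto)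
  then show "\<delta> = 0" using riesz_UU[OF ext] by simp
  have "riesz \<gamma> (S * S) = 0" by (rule null) (use monic S_orth[OF ext] p(2) in auto)
  then show "\<gamma> (2 * m + 4) = L" using riesz_SS[OF ext] by simp
qed

text \<open>One degree more than in the singular case: remainders reach degree m + 1, where
  \<open>S\<close> and \<open>Q y\<close> are still orthogonal although \<open>W\<close> and
  \<open>U\<close> need not be.\<close>

lemma few_atoms_gap:
  assumes p: "p \<noteq> 0" "degree p \<le> m + 2" "AE t in \<mu>. poly p t = 0"
  shows "\<gamma> (2 * m + 4) = L \<and> (L - R)\<^sup>2 = \<alpha> * \<delta>"
proof -
  define y where "y = \<gamma> (2 * m + 4)"
  note null = representing_measure_orthogonal_null[OF \<mu> p(1,3)]
  have "riesz \<gamma> (S * S) = 0" by (rule null) (use monic S_orth[OF ext] p(2) in auto)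
  then have yL: "y = L" using riesz_SS[OF ext] y_def by simp
  have "(y - R)\<^sup>2 = \<alpha> * \<delta>"
  proof (cases "\<alpha> = 0")
    case False
    have "riesz \<gamma> (Q y * Q y) = 0"
      by (rule null) (use monic_Q Q_orth[OF ext _ gap_Schur_0] p(2) y_def in auto)
    then have "(y - R)\<^sup>2 / \<alpha> = \<delta>"
      using riesz_QQ[OF ext refl gap_Schur_0] y_def by simp
    then show ?thesis using False by (simp add: field_simps)
  qed (use gap_Schur_0 y_def in simp)
  then show ?thesis using yL y_def by simp
qed

end

end

section \<open>Bordered matrices and Schur complements\<close>

lemma hankel_Suc_bordered:
  fixes \<beta> :: "nat \<Rightarrow> real"
  shows "hankel (m + 1) \<beta> = four_block_mat (hankel m \<beta>)
    (mat_of_row (Matrix.vec (m + 1) (\<lambda>i. \<beta> (m + 1 + i))))\<^sup>T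
    (mat_of_row (Matrix.vec (m + 1) (\<lambda>i. \<beta> (m + 1 + i)))) (Matrix.mat 1 1 (\<lambda>_. \<beta> (2 * m + 2)))"
  by (rule eq_matI) (auto simp: hankel_def mult_2 add_ac not_less less_Suc_eq)

lemma schur_complement_bordered:
  assumes A: "A \<in> carrier_mat n n" "A\<^sup>T = A" and q: "q \<in> carrier_vec n"
  shows "schur_complement (four_block_mat A (mat_of_row q)\<^sup>T (mat_of_row q) (Matrix.mat 1 1 (\<lambda>_. d))) n $$ (0, 0)
    = d - q \<bullet> (pinv A *\<^sub>v q)"
proof -
  let ?M = "four_block_mat A (mat_of_row q)\<^sup>T (mat_of_row q) (Matrix.mat 1 1 (\<lambda>_. d))"
  have X: "pinv A \<in> carrier_mat n n"
    using is_moore_penrose_pinv[OF A] A(1) by (simp add: is_moore_penrose_def)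
  have "split_block ?M n n = (A, (mat_of_row q)\<^sup>T, mat_of_row q, Matrix.mat 1 1 (\<lambda>_. d))"
    using A(1) q by (auto simp: split_block_def Let_def intro!: eq_matI)
  then have "schur_complement ?M n $$ (0, 0)
      = d - (mat_of_row q * pinv A * (mat_of_row q)\<^sup>T) $$ (0, 0)"
    using q X by (simp add: schur_complement_def)
  also have "mat_of_row q * pinv A * (mat_of_row q)\<^sup>T = mat_of_row q * (pinv A * (mat_of_row q)\<^sup>T)"
    using q X by (intro assoc_mult_mat) auto
  also have "\<dots> $$ (0, 0) = q \<bullet> (pinv A *\<^sub>v q)"
  proof -
    have "col (pinv A * (mat_of_row q)\<^sup>T) 0 = pinv A *\<^sub>v q"
      using X q by (intro eq_vecI) (auto simp: col_transpose)
    then show ?thesis using q X by simp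
  qed
  finally show ?thesis .
qed

text \<open>The bordered matrix maps the vector (- c, 1) to (0, ..., 0, d - q . c), so the Schur
  complement is a value of the quadratic form.\<close>

lemma psd_bordered_Schur_nonneg:
  assumes A: "A \<in> carrier_mat n n" and c: "c \<in> carrier_vec n" "A *\<^sub>v c = q"
    and psd: "psd_mat (four_block_mat A (mat_of_row q)\<^sup>T (mat_of_row q) (Matrix.mat 1 1 (\<lambda>_. d)))"
  shows "q \<bullet> c \<le> d"
proof -
  let ?M = "four_block_mat A (mat_of_row q)\<^sup>T (mat_of_row q) (Matrix.mat 1 1 (\<lambda>_. d))"
  have q: "q \<in> carrier_vec n" using A c by auto
  define v where "v = Matrix.vec (n + 1) (\<lambda>i. if i < n then - c $ i else 1)"
  have Mv: "(?M *\<^sub>v v) $ i = (if i < n then 0 else d - q \<bullet> c)" if i: "i < n + 1" for i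
  proof (cases "i < n")
    case True
    have "(?M *\<^sub>v v) $ i = (\<Sum>j<Suc n. ?M $$ (i, j) * v $ j)"
      using i A q by (auto simp: scalar_prod_def atLeast0LessThan v_def)
    also have "\<dots> = (\<Sum>j<n. A $$ (i, j) * - c $ j) + q $ i"
      using True A q by (auto simp: v_def intro!: sum.cong)
    also have "(\<Sum>j<n. A $$ (i, j) * - c $ j) = - (A *\<^sub>v c) $ i"
      using True A c(1) by (auto simp: scalar_prod_def atLeast0LessThan sum_negf)
    finally show ?thesis using True c(2) by simp
  next
    case False
    then have "i = n" using i by simp
    have "(?M *\<^sub>v v) $ i = (\<Sum>j<Suc n. ?M $$ (i, j) * v $ j)"
      using i A q by (auto simp: scalar_prod_def atLeast0LessThan v_def)
    also have "\<dots> = (\<Sum>j<n. q $ j * - c $ j) + d"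
      using \<open>i = n\<close> A q by (auto simp: v_def intro!: sum.cong)
    finally show ?thesis
      using False c(1) by (simp add: scalar_prod_def atLeast0LessThan sum_negf)
  qed
  have "v \<bullet> (?M *\<^sub>v v) = (\<Sum>i<Suc n. v $ i * (?M *\<^sub>v v) $ i)"
    using A q by (simp add: scalar_prod_def[of v] atLeast0LessThan del: index_mult_mat_vec)
  also have "\<dots> = d - q \<bullet> c"
    using Mv by (simp add: v_def del: index_mult_mat_vec)
  finally have "v \<bullet> (?M *\<^sub>v v) = d - q \<bullet> c" .
  moreover have "v \<in> carrier_vec (dim_row ?M)" using A by (simp add: v_def)
  ultimately show ?thesis using psd unfolding psd_mat_def by force
qed

lemma submatrix_eqI:
  assumes P: "P \<in> carrier_mat N N" and I: "I \<subseteq> {0..<N}" "card I = n"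
    and pick: "\<And>i. i < n \<Longrightarrow> pick I i = f i" and M: "M \<in> carrier_mat n n"
    and eq: "\<And>i j. i < n \<Longrightarrow> j < n \<Longrightarrow> the (P $$ (f i, f j)) = M $$ (i, j)"
  shows "map_mat the (submatrix P I I) = M"
proof -
  have *: "{i. i < N \<and> i \<in> I} = I" using I by auto
  show ?thesis
    by (rule eq_matI) (use assms * in \<open>auto simp: dim_submatrix submatrix_index\<close>)
qed

lemma partially_psd_imp_psd_hankel:
  assumes psd: "partially_psd (hankel (m + 3) (partial_seq (m + 3) \<beta>))"
  shows "psd_mat (hankel (m + 1) \<beta>)"
proof -
  let ?I = "{0..<m + 2}"
  have "map_mat the (submatrix (hankel (m + 3) (partial_seq (m + 3) \<beta>)) ?I ?I) = hankel (m + 1) \<beta>"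
  proof (rule submatrix_eqI[where N = "m + 4" and n = "m + 2" and f = "\<lambda>i. i"])
    fix i assume i: "i < m + 2"
    then have "{a \<in> ?I. a < i} = {0..<i}" by auto
    then show "pick ?I i = i" using pick_card_in_set[of i ?I] i by simp
  qed (auto simp: hankel_def partial_seq_def)
  moreover have "?I \<subseteq> {0..<dim_row (hankel (m + 3) (partial_seq (m + 3) \<beta>))}" by simp
  moreover have "\<forall>i\<in>?I. \<forall>j\<in>?I. hankel (m + 3) (partial_seq (m + 3) \<beta>) $$ (i, j) \<noteq> None"
    by (auto simp: partial_seq_def)
  ultimately show ?thesis using psd unfolding partially_psd_def by metis
qed

lemma partially_psd_imp_psd_bordered:
  fixes \<beta> :: "nat \<Rightarrow> real"
  assumes psd: "partially_psd (hankel (m + 3) (partial_seq (m + 3) \<beta>))"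
    and u: "u = Matrix.vec (m + 1) (\<lambda>i. \<beta> (m + 3 + i))"
  shows "psd_mat (four_block_mat (hankel m \<beta>) (mat_of_row u)\<^sup>T (mat_of_row u)
    (Matrix.mat 1 1 (\<lambda>_. \<beta> (2 * m + 6))))" (is "psd_mat ?B")
proof -
  \<comment> \<open>Rows 0, ..., k - 3 together with row k: the index sums are at most 2k - 3 or
    equal to 2k, so every entry is specified.\<close>
  let ?I = "insert (m + 3) {0..<m + 1}"
  let ?f = "\<lambda>i. if i < m + 1 then i else m + 3"
  have "map_mat the (submatrix (hankel (m + 3) (partial_seq (m + 3) \<beta>)) ?I ?I) = ?B"
  proof (rule submatrix_eqI[where N = "m + 4" and n = "m + 2" and f = ?f])
    fix i assume i: "i < m + 2"
    show "pick ?I i = ?f i"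
    proof (cases "i < m + 1")
      case True
      then have "{a \<in> ?I. a < i} = {0..<i}" by auto
      then show ?thesis using pick_card_in_set[of i ?I] True by simp
    next
      case False
      then have "i = m + 1" using i by simp
      moreover have "{a \<in> ?I. a < m + 3} = {0..<m + 1}" by auto
      ultimately show ?thesis using pick_card_in_set[of "m + 3" ?I] by simp
    qed
  next
    fix i j assume "i < m + 2" "j < m + 2"
    then show "the (hankel (m + 3) (partial_seq (m + 3) \<beta>) $$ (?f i, ?f j)) = ?B $$ (i, j)"
      by (auto simp: hankel_def partial_seq_def u add_ac mult_2 numeral_eq_Suc)
  next
    show "?B \<in> carrier_mat (m + 2) (m + 2)"
      using four_block_carrier_mat[of "hankel m \<beta>" "m + 1" "m + 1" "Matrix.mat 1 1 (\<lambda>_. \<beta> (2 * m + 6))" 1 1]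
      by simp
  qed (auto simp: hankel_def)
  moreover have "?I \<subseteq> {0..<dim_row (hankel (m + 3) (partial_seq (m + 3) \<beta>))}" by simp
  moreover have "\<forall>i\<in>?I. \<forall>j\<in>?I. hankel (m + 3) (partial_seq (m + 3) \<beta>) $$ (i, j) \<noteq> None"
    by (auto simp: partial_seq_def)
  ultimately show ?thesis using psd unfolding partially_psd_def by metis
qed

lemma hankel_solution_sum:
  fixes \<gamma> :: "nat \<Rightarrow> real"
  assumes "v \<in> carrier_vec (Suc n)" "hankel n \<gamma> *\<^sub>v v = q" "j \<le> n"
  shows "(\<Sum>i<Suc n. v $ i * \<gamma> (i + j)) = q $ j"
  using hankel_mult_vec[OF assms(1,3), of \<gamma>] riesz_vpoly_mult[OF assms(1), of \<gamma> j] assms(2) by simp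

text \<open>A kernel vector of the small matrix is a null polynomial, hence orthogonal to t^j even
  for j beyond the small matrix. With j = k - 2, k - 1, k this shows that w, s, u are orthogonal to
  the respective kernels.\<close>

lemma hankel_kernel_orthogonal:
  assumes psd: "\<And>q. degree q \<le> N \<Longrightarrow> 0 \<le> riesz \<gamma> (q * q)" and n: "n \<le> N" "j \<le> N"
    and z: "z \<in> carrier_vec (Suc n)" "hankel n \<gamma> *\<^sub>v z = 0\<^sub>v (Suc n)"
  shows "Matrix.vec (Suc n) (\<lambda>i. \<gamma> (j + i)) \<bullet> z = 0"
proof -
  have null: "riesz \<gamma> (vpoly z * vpoly z) = 0"
    using hankel_quadratic_form[OF z(1) z(1), of \<gamma>] z by simp
  have "riesz \<gamma> (vpoly z * monom 1 j) = 0"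
    using psd order.trans[OF degree_vpoly[OF z(1)] n(1)] null order.trans[OF degree_monom_le n(2)]
    by (rule riesz_null)
  then have "(\<Sum>i<Suc n. z $ i * \<gamma> (i + j)) = 0"
    using riesz_vpoly_mult[OF z(1), of \<gamma> j] by simp
  then show ?thesis
    using z(1) by (simp add: scalar_prod_def atLeast0LessThan add.commute mult.commute)
qed

lemma symmetric_solutions_same_value:
  fixes A :: "real mat"
  assumes A: "A \<in> carrier_mat n n" "A\<^sup>T = A"
    and x: "x \<in> carrier_vec n" "A *\<^sub>v x = q" and z: "z \<in> carrier_vec n" "A *\<^sub>v z = q"
  shows "q \<bullet> x = q \<bullet> z"
proof -
  have "(A\<^sup>T *\<^sub>v x) \<bullet> z = x \<bullet> (A *\<^sub>v z)"
    using A x z by (intro transpose_vec_mult_scalar) auto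
  then show ?thesis using A x z by (metis comm_scalar_prod mult_mat_vec_carrier)
qed

section \<open>Existence and atom counts in terms of \<open>L\<close>, \<open>R\<close>, \<alpha>
  and \<delta>\<close>

context gapped_hankel
begin

abbreviation "At \<equiv> hankel (m + 1) \<beta>"

lemma extends_self: "extends \<beta>"
  by (simp add: extends_def)

lemma Schur_At:
  assumes "psd_mat At"
  shows "0 \<le> \<alpha>" "pd_mat At \<Longrightarrow> 0 < \<alpha>"
proof -
  show "0 \<le> \<alpha>"
    using assms monic(3) riesz_WW[OF extends_self] unfolding psd_hankel_iff by (metis order.refl)
  show "pd_mat At \<Longrightarrow> 0 < \<alpha>"
    using monic(3) nonzero(2) riesz_WW[OF extends_self] unfolding pd_hankel_iff by (metis order.refl)
qed

text \<open>Cauchy-Schwarz allows y up to R + sqrt (\<alpha> * \<delta>); this largest value is the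
  one most favourable to L \<le> y, and it is an end point.\<close>

lemma gap_sufficient:
  assumes psd: "psd_mat At" and \<delta>: "0 \<le> \<delta>" "\<alpha> = 0 \<Longrightarrow> \<delta> = 0" and L: "L \<le> R + sqrt (\<alpha> * \<delta>)"
  shows "has_atomic_representing_measure (seq_rank (m + 1) \<beta>) (m + 3) \<beta> \<or>
    has_atomic_representing_measure (seq_rank (m + 1) \<beta> + 1) (m + 3) \<beta>"
proof -
  have "(R + sqrt (\<alpha> * \<delta>) - R)\<^sup>2 = \<alpha> * \<delta>"
    using Schur_At(1)[OF psd] \<delta>(1) by simp
  from has_atomic_representing_measure_gap[OF psd this L \<delta>(2)] show ?thesis
    by (auto split: if_splits)
qed

context
  fixes x y :: real and \<mu> :: "real measure"
  assumes \<mu>: "representing_measure (2 * (m + 3)) (completion (m + 3) \<beta> x y) \<mu>"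
begin

lemma completion_gap: "completion (m + 3) \<beta> x y (2 * m + 4) = y"
  by (simp add: completion_def)

lemmas gap = gap_lower_bound[OF extends_completion \<mu>, unfolded completion_gap]
  gap_Cauchy_Schwarz[OF extends_completion \<mu>, unfolded completion_gap]
  gap_Schur_0[OF extends_completion \<mu>, unfolded completion_gap]

lemma gap_necessary: "L \<le> R + sqrt (\<alpha> * \<delta>)"
  using gap(1) real_le_rsqrt[OF gap(2)] by simp

lemma psd_At: "psd_mat At"
  unfolding psd_hankel_iff
proof (intro allI impI)
  fix p :: "real poly" assume p: "degree p \<le> m + 1"
  then have "0 \<le> riesz (completion (m + 3) \<beta> x y) (p * p)"
    by (intro representing_measure_riesz_nonneg[OF \<mu>]) simp
  also have "\<dots> = riesz \<beta> (p * p)"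
    using p degree_mult_le[of p p] extends_completion by (intro riesz_cong extends_le) auto
  finally show "0 \<le> riesz \<beta> (p * p)" .
qed

lemma singular_gap_values:
  assumes "\<not> pd_mat At"
  shows "\<alpha> = 0" "\<delta> = 0" "L = R"
proof -
  obtain p where p: "degree p \<le> m + 1" "p \<noteq> 0" "riesz \<beta> (p * p) \<le> 0"
    using assms by (auto simp: pd_hankel_iff not_less)
  \<comment> \<open>The square of p has degree at most 2 m + 2 and stays below the gap, so p is null
    for the completion too.\<close>
  have "riesz (completion (m + 3) \<beta> x y) (p * p) = riesz \<beta> (p * p)"
    using p(1) degree_mult_le[of p p] extends_completion by (intro riesz_cong extends_le) auto
  then have "riesz (completion (m + 3) \<beta> x y) (p * p) = 0"
    using p representing_measure_riesz_nonneg[OF \<mu>, of p] by simp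
  then have "AE t in \<mu>. poly p t = 0"
    using p(1) by (intro representing_measure_null_AE[OF \<mu>]) auto
  from singular_gap[OF extends_completion \<mu> p(2,1) this]
  show "\<alpha> = 0" "\<delta> = 0" "L = R" using gap(3) completion_gap by auto
qed

text \<open>An atomic measure may belong to other values of x and y than \<mu>; the comparison is
  possible because \<open>L\<close>, \<open>R\<close>, \<alpha>, \<delta> do not depend on the
  completion.\<close>

lemma has_seq_rank_atoms_iff:
  "has_atomic_representing_measure (seq_rank (m + 1) \<beta>) (m + 3) \<beta> \<longleftrightarrow>
    L = R - sqrt (\<alpha> * \<delta>) \<or> L = R + sqrt (\<alpha> * \<delta>)" (is "?atomic \<longleftrightarrow> ?flat")
proof -
  have nonneg: "0 \<le> \<alpha> * \<delta>"
    using gap_Schur_nonneg[OF extends_completion \<mu>] by simp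
  have flat_iff: "?flat \<longleftrightarrow> (L - R)\<^sup>2 = \<alpha> * \<delta>"
  proof
    assume "(L - R)\<^sup>2 = \<alpha> * \<delta>"
    then have "sqrt (\<alpha> * \<delta>) = \<bar>L - R\<bar>" by (metis real_sqrt_abs)
    then show ?flat by linarith
  qed (use nonneg in auto)
  show ?thesis
  proof
    assume ?atomic
    then obtain x' y' \<nu> where \<nu>: "representing_measure (2 * (m + 3)) (completion (m + 3) \<beta> x' y') \<nu>"
        "atomic_measure (seq_rank (m + 1) \<beta>) \<nu>"
      unfolding has_atomic_representing_measure_def by blast
    obtain p where p: "p \<noteq> 0" "degree p = seq_rank (m + 1) \<beta>" "AE t in \<nu>. poly p t = 0"
      using atomic_measure_AE_poly[OF \<nu>(2)] by blast
    \<comment> \<open>With at most k - 1 atoms, remainders modulo p stay within the degrees to which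
      both \<open>S\<close> and \<open>Q\<close> are orthogonal.\<close>
    have "seq_rank (m + 1) \<beta> \<le> m + 2"
      using seq_rank_pd[of "m + 1" \<beta>] seq_rank_psd_singular[OF psd_At]
      by (cases "pd_mat At") (simp, metis le_SucI add_Suc_right one_add_one plus_1_eq_Suc)
    then show ?flat
      using few_atoms_gap[OF extends_completion \<nu>(1) p(1) _ p(3)] p(2) flat_iff by simp
  next
    assume ?flat
    then have LR: "(L - R)\<^sup>2 = \<alpha> * \<delta>" by (simp only: flat_iff)
    have "\<alpha> = 0 \<Longrightarrow> \<delta> = 0"
      using Schur_At(2)[OF psd_At] singular_gap_values by fastforce
    from has_atomic_representing_measure_gap[OF psd_At LR order.refl this] show ?atomic
      by simp
  qed
qed

end

end

section \<open>The truncated moment problem with a gap\<close>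

lemma has_representing_measure_if_atomic:
  "has_atomic_representing_measure r k \<beta> \<Longrightarrow> has_representing_measure k \<beta>"
  unfolding has_atomic_representing_measure_def has_representing_measure_def by blast

text \<open>Writing k = m + 3 keeps truncated subtraction out of the indices. What must be added to
  the locale results is that either side of the equivalence makes the three linear systems
  solvable.\<close>

lemma gap_moment_problem:
  fixes m :: nat and \<beta> :: "nat \<Rightarrow> real"
    and A\<^sub>h A\<^sub>t B :: "real mat" and u s w :: "real vec" and L R D :: real
  assumes A\<^sub>h: "A\<^sub>h = hankel m \<beta>"
    and A\<^sub>t: "A\<^sub>t = hankel (m + 1) \<beta>"
    and u: "u = Matrix.vec (m + 1) (\<lambda>i. \<beta> (m + 3 + i))"
    and s: "s = Matrix.vec (m + 2) (\<lambda>i. \<beta> (m + 2 + i))"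
    and w: "w = Matrix.vec (m + 1) (\<lambda>i. \<beta> (m + 1 + i))"
    and B: "B = four_block_mat A\<^sub>h (mat_of_row u)\<^sup>T (mat_of_row u) (Matrix.mat 1 1 (\<lambda>_. \<beta> (2 * m + 6)))"
    and L: "L = s \<bullet> (pinv A\<^sub>t *\<^sub>v s)"
    and R: "R = u \<bullet> (pinv A\<^sub>h *\<^sub>v w)"
    and D: "D = sqrt (schur_complement A\<^sub>t (m + 1) $$ (0, 0) * schur_complement B (m + 1) $$ (0, 0))"
  shows "has_representing_measure (m + 3) \<beta> \<longleftrightarrow>
        has_atomic_representing_measure (seq_rank (m + 1) \<beta>) (m + 3) \<beta> \<or>
        has_atomic_representing_measure (seq_rank (m + 1) \<beta> + 1) (m + 3) \<beta>" (is "?rep \<longleftrightarrow> ?atomic")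
    and "has_representing_measure (m + 3) \<beta> \<longleftrightarrow>
        partially_psd (hankel (m + 3) (partial_seq (m + 3) \<beta>)) \<and>
        L \<le> R + D \<and>
           (pd_mat A\<^sub>t \<or>
            mat_rank A\<^sub>h = mat_rank A\<^sub>t \<and>
            mat_rank A\<^sub>t = mat_rank (mat_of_cols (m + 2) (cols A\<^sub>t @ [s])) \<and>
            mat_rank (mat_of_cols (m + 2) (cols A\<^sub>t @ [s])) = mat_rank B)" (is "_ \<longleftrightarrow> ?cond")
    and "has_representing_measure (m + 3) \<beta> \<Longrightarrow>
        has_atomic_representing_measure (seq_rank (m + 1) \<beta>) (m + 3) \<beta> \<longleftrightarrow> L = R - D \<or> L = R + D"
proof -
  define a b c where "a = pinv A\<^sub>t *\<^sub>v s" and "b = pinv A\<^sub>h *\<^sub>v w" and "c = pinv A\<^sub>h *\<^sub>v u"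
  have h: "A\<^sub>h \<in> carrier_mat (m + 1) (m + 1)" "A\<^sub>h\<^sup>T = A\<^sub>h" "dim_row A\<^sub>h = m + 1"
    using hankel_sym by (simp_all add: A\<^sub>h)
  have t: "A\<^sub>t \<in> carrier_mat (m + 2) (m + 2)" "A\<^sub>t\<^sup>T = A\<^sub>t" "dim_row A\<^sub>t = m + 2"
    using hankel_sym[of "m + 1" \<beta>] by (simp_all add: A\<^sub>t)
  have vecs: "u \<in> carrier_vec (m + 1)" "w \<in> carrier_vec (m + 1)" "s \<in> carrier_vec (m + 2)"
    by (simp_all add: u w s)
  have At_bordered: "A\<^sub>t = four_block_mat A\<^sub>h (mat_of_row w)\<^sup>T (mat_of_row w) (Matrix.mat 1 1 (\<lambda>_. \<beta> (2 * m + 2)))"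
    unfolding A\<^sub>t A\<^sub>h w by (rule hankel_Suc_bordered)
  \<comment> \<open>Orthogonality to the kernel is what makes \<open>pinv\<close> of a symmetric
    matrix return a solution; phrased this way, the definite and the singular case enter the locale
    alike.\<close>
  define solvable where "solvable \<longleftrightarrow>
    (\<forall>z\<in>carrier_vec (m + 1). A\<^sub>h *\<^sub>v z = 0\<^sub>v (m + 1) \<longrightarrow> u \<bullet> z = 0 \<and> w \<bullet> z = 0) \<and>
    (\<forall>z\<in>carrier_vec (m + 2). A\<^sub>t *\<^sub>v z = 0\<^sub>v (m + 2) \<longrightarrow> s \<bullet> z = 0)"
  have sol: "a \<in> carrier_vec (m + 2)" "b \<in> carrier_vec (m + 1)" "c \<in> carrier_vec (m + 1)"
    "A\<^sub>t *\<^sub>v a = s" "A\<^sub>h *\<^sub>v b = w" "A\<^sub>h *\<^sub>v c = u" if solvable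
    using symmetric_pinv_solves[OF t(1,2) vecs(3)] symmetric_pinv_solves[OF h(1,2) vecs(2)]
      symmetric_pinv_solves[OF h(1,2) vecs(1)] that
    unfolding a_def b_def c_def solvable_def by blast+
  have gap: "gapped_hankel m \<beta> a b c" if solvable
  proof
    note sol = sol[OF that]
    show "a \<in> carrier_vec (m + 2)" "b \<in> carrier_vec (m + 1)" "c \<in> carrier_vec (m + 1)"
      by (fact sol)+
    fix j
    show "(\<Sum>i<m + 2. a $ i * \<beta> (i + j)) = \<beta> (m + 2 + j)" if "j \<le> m + 1"
      using hankel_solution_sum[of a "m + 1" \<beta> s j] sol(1,4) that by (simp add: A\<^sub>t s del: sum.lessThan_Suc)
    show "(\<Sum>i<m + 1. b $ i * \<beta> (i + j)) = \<beta> (m + 1 + j)" if "j \<le> m"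
      using hankel_solution_sum[of b m \<beta> w j] sol(2,5) that by (simp add: A\<^sub>h w del: sum.lessThan_Suc)
    show "(\<Sum>i<m + 1. c $ i * \<beta> (i + j)) = \<beta> (m + 3 + j)" if "j \<le> m"
      using hankel_solution_sum[of c m \<beta> u j] sol(3,6) that by (simp add: A\<^sub>h u del: sum.lessThan_Suc)
  qed
  have scalar_prod_vec: "Matrix.vec n f \<bullet> v = (\<Sum>i<n. v $ i * f i)" if "v \<in> carrier_vec n"
    for n f and v :: "real vec"
    using that by (simp add: scalar_prod_def atLeast0LessThan mult.commute)
  have schur: "schur_complement A\<^sub>t (m + 1) $$ (0, 0) = \<beta> (2 * m + 2) - w \<bullet> b"
    "schur_complement B (m + 1) $$ (0, 0) = \<beta> (2 * m + 6) - u \<bullet> c"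
    unfolding At_bordered B b_def c_def by (rule schur_complement_bordered[OF h(1,2)], fact vecs)+
  have gap_values: "gapped_hankel.L m \<beta> a = L" "gapped_hankel.R m \<beta> b = R"
    "gapped_hankel.\<alpha> m \<beta> b = \<beta> (2 * m + 2) - w \<bullet> b" "gapped_hankel.\<delta> m \<beta> c = \<beta> (2 * m + 6) - u \<bullet> c" if solvable
  proof -
    interpret G: gapped_hankel m \<beta> a b c by (rule gap[OF that])
    show "gapped_hankel.L m \<beta> a = L"
      using scalar_prod_vec[OF G.carrier(1), of "\<lambda>i. \<beta> (m + 2 + i)"]
      unfolding L a_def[symmetric] s[symmetric] G.L_def by (simp only: add_ac)
    show "gapped_hankel.R m \<beta> b = R"
      using scalar_prod_vec[OF G.carrier(2), of "\<lambda>i. \<beta> (m + 3 + i)"]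
      unfolding R b_def[symmetric] u[symmetric] G.R_def by (simp only: add_ac)
    show "gapped_hankel.\<alpha> m \<beta> b = \<beta> (2 * m + 2) - w \<bullet> b"
      using scalar_prod_vec[OF G.carrier(2), of "\<lambda>i. \<beta> (m + 1 + i)"]
      unfolding w[symmetric] G.\<alpha>_def by (simp only: add_ac)
    show "gapped_hankel.\<delta> m \<beta> c = \<beta> (2 * m + 6) - u \<bullet> c"
      using scalar_prod_vec[OF G.carrier(3), of "\<lambda>i. \<beta> (m + 3 + i)"]
      unfolding u[symmetric] G.\<delta>_def by (simp only: add_ac)
  qed
  have D_eq: "D = sqrt (gapped_hankel.\<alpha> m \<beta> b * gapped_hankel.\<delta> m \<beta> c)" if solvable
    unfolding D schur gap_values(3,4)[OF that] ..
  have bordered_B: "B = four_block_mat (hankel m \<beta>) (mat_of_row u)\<^sup>T (mat_of_row u) (Matrix.mat 1 1 (\<lambda>_. \<beta> (2 * m + 6)))"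
    by (simp only: B A\<^sub>h)
  have rank_h_t: "mat_rank A\<^sub>h = mat_rank A\<^sub>t \<longleftrightarrow> (\<exists>x\<in>carrier_vec (m + 1). A\<^sub>h *\<^sub>v x = w \<and> w \<bullet> x = \<beta> (2 * m + 2))"
    by (rule bordered_rank_eq_iff[OF h(1,2) vecs(2) At_bordered])
  have rank_h_B: "mat_rank A\<^sub>h = mat_rank B \<longleftrightarrow> (\<exists>x\<in>carrier_vec (m + 1). A\<^sub>h *\<^sub>v x = u \<and> u \<bullet> x = \<beta> (2 * m + 6))"
    by (rule bordered_rank_eq_iff[OF h(1,2) vecs(1) B])
  have rank_t_s: "mat_rank A\<^sub>t = mat_rank (mat_of_cols (m + 2) (cols A\<^sub>t @ [s])) \<longleftrightarrow>
      (\<exists>x\<in>carrier_vec (m + 2). A\<^sub>t *\<^sub>v x = s)"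
    by (rule rank_append_vec_eq_iff[OF t(1) vecs(3)])
  have solvable_if_measure: solvable
    if \<mu>: "representing_measure (2 * (m + 3)) (completion (m + 3) \<beta> x y) \<mu>" for x y \<mu>
  proof -
    define \<gamma> where "\<gamma> = completion (m + 3) \<beta> x y"
    have \<gamma>: "\<gamma> i = \<beta> i" if "i \<le> 2 * m + 3" for i
      using that by (simp add: \<gamma>_def completion_def)
    have psd: "0 \<le> riesz \<gamma> (q * q)" if "degree q \<le> m + 3" for q
      using representing_measure_riesz_nonneg[OF \<mu> that] by (simp add: \<gamma>_def)
    have h\<gamma>: "hankel m \<gamma> = A\<^sub>h" and t\<gamma>: "hankel (m + 1) \<gamma> = A\<^sub>t"
      unfolding A\<^sub>h A\<^sub>t using \<gamma> by (auto simp: hankel_def intro!: eq_matI)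
    have "Matrix.vec (Suc m) (\<lambda>i. \<gamma> (m + 1 + i)) = w" "Matrix.vec (Suc m) (\<lambda>i. \<gamma> (m + 3 + i)) = u"
      "Matrix.vec (Suc (m + 1)) (\<lambda>i. \<gamma> (m + 2 + i)) = s"
      unfolding w u s using \<gamma> by (auto intro!: eq_vecI)
    then have "w \<bullet> z = 0 \<and> u \<bullet> z = 0" if "z \<in> carrier_vec (m + 1)" "A\<^sub>h *\<^sub>v z = 0\<^sub>v (m + 1)" for z
      using hankel_kernel_orthogonal[where \<gamma> = \<gamma> and N = "m + 3" and n = m and j = "m + 1" and z = z]
        hankel_kernel_orthogonal[where \<gamma> = \<gamma> and N = "m + 3" and n = m and j = "m + 3" and z = z]
        psd that h\<gamma> by simp
    moreover have "s \<bullet> z = 0" if "z \<in> carrier_vec (m + 2)" "A\<^sub>t *\<^sub>v z = 0\<^sub>v (m + 2)" for z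
      using hankel_kernel_orthogonal[where \<gamma> = \<gamma> and N = "m + 3" and n = "m + 1" and j = "m + 2" and z = z]
        psd that t\<gamma> \<open>Matrix.vec (Suc (m + 1)) (\<lambda>i. \<gamma> (m + 2 + i)) = s\<close> by simp
    ultimately show ?thesis unfolding solvable_def by blast
  qed
  have nec: ?cond if ?rep
  proof -
    from that obtain x y \<mu> where \<mu>: "representing_measure (2 * (m + 3)) (completion (m + 3) \<beta> x y) \<mu>"
      unfolding has_representing_measure_def by blast
    have solvable by (rule solvable_if_measure[OF \<mu>])
    note sol = sol[OF \<open>solvable\<close>] and vals = gap_values[OF \<open>solvable\<close>] D_eq[OF \<open>solvable\<close>]
    interpret G: gapped_hankel m \<beta> a b c by (rule gap[OF \<open>solvable\<close>])
    have "L \<le> R + D" using G.gap_necessary[OF \<mu>] vals by simp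
    moreover have "mat_rank A\<^sub>h = mat_rank A\<^sub>t \<and>
        mat_rank A\<^sub>t = mat_rank (mat_of_cols (m + 2) (cols A\<^sub>t @ [s])) \<and>
        mat_rank (mat_of_cols (m + 2) (cols A\<^sub>t @ [s])) = mat_rank B" if "\<not> pd_mat A\<^sub>t"
    proof -
      from G.singular_gap_values[OF \<mu>] that have "G.\<alpha> = 0" "G.\<delta> = 0" by (simp_all add: A\<^sub>t)
      then have "w \<bullet> b = \<beta> (2 * m + 2)" "u \<bullet> c = \<beta> (2 * m + 6)" using vals by simp_all
      then have "mat_rank A\<^sub>h = mat_rank A\<^sub>t" "mat_rank A\<^sub>h = mat_rank B"
        "mat_rank A\<^sub>t = mat_rank (mat_of_cols (m + 2) (cols A\<^sub>t @ [s]))"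
        using rank_h_t rank_h_B rank_t_s sol by blast+
      then show ?thesis by simp
    qed
    ultimately show ?thesis using representing_measure_partially_psd[OF \<mu>] by blast
  qed
  have suf: ?atomic if ?cond
  proof -
    have psd_t: "psd_mat A\<^sub>t" using that partially_psd_imp_psd_hankel unfolding A\<^sub>t by blast
    have psd_B: "psd_mat B" using that partially_psd_imp_psd_bordered[OF _ u] unfolding bordered_B by blast
    have ranks: "mat_rank A\<^sub>h = mat_rank A\<^sub>t" "mat_rank A\<^sub>h = mat_rank B"
      "mat_rank A\<^sub>t = mat_rank (mat_of_cols (m + 2) (cols A\<^sub>t @ [s]))" if "\<not> pd_mat A\<^sub>t"
      using \<open>?cond\<close> that by simp_all
    have solvable
    proof (cases "pd_mat A\<^sub>t")
      case True
      have triv_t: "z = 0\<^sub>v (m + 2)" if "z \<in> carrier_vec (m + 2)" "A\<^sub>t *\<^sub>v z = 0\<^sub>v (m + 2)" for z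
        using True that t(1) unfolding pd_mat_def by (metis carrier_matD(1) less_irrefl scalar_prod_right_zero)
      have "pd_mat A\<^sub>h" using True unfolding A\<^sub>h A\<^sub>t pd_hankel_iff by simp
      then have triv_h: "z = 0\<^sub>v (m + 1)" if "z \<in> carrier_vec (m + 1)" "A\<^sub>h *\<^sub>v z = 0\<^sub>v (m + 1)" for z
        using that h(1) unfolding pd_mat_def by (metis carrier_matD(1) less_irrefl scalar_prod_right_zero)
      show ?thesis unfolding solvable_def using triv_t triv_h vecs by (metis scalar_prod_right_zero)
    next
      case False
      then obtain xw xu xs where "xw \<in> carrier_vec (m + 1)" "A\<^sub>h *\<^sub>v xw = w"
        "xu \<in> carrier_vec (m + 1)" "A\<^sub>h *\<^sub>v xu = u" "xs \<in> carrier_vec (m + 2)" "A\<^sub>t *\<^sub>v xs = s"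
        using ranks rank_h_t rank_h_B rank_t_s by blast
      then show ?thesis unfolding solvable_def
        using symmetric_solvable_kernel[OF h(1,2)] symmetric_solvable_kernel[OF t(1,2)] by blast
    qed
    note sol = sol[OF \<open>solvable\<close>] and vals = gap_values[OF \<open>solvable\<close>] D_eq[OF \<open>solvable\<close>]
    interpret G: gapped_hankel m \<beta> a b c by (rule gap[OF \<open>solvable\<close>])
    have "0 \<le> G.\<delta>"
      using psd_bordered_Schur_nonneg[OF h(1) sol(3,6) psd_B[unfolded B]] vals by simp
    \<comment> \<open>\<alpha> = 0 excludes definiteness, so the rank equalities hold and give a
      solution z of the system for u with u . z = \<beta>_(2k); this value is the same for all
      solutions, in particular for c.\<close>
    moreover have "G.\<delta> = 0" if "G.\<alpha> = 0"
    proof -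
      have "\<not> pd_mat A\<^sub>t" using G.Schur_At(2) psd_t that by (auto simp: A\<^sub>t)
      then obtain z where "z \<in> carrier_vec (m + 1)" "A\<^sub>h *\<^sub>v z = u" "u \<bullet> z = \<beta> (2 * m + 6)"
        using ranks rank_h_B by blast
      then show ?thesis
        using symmetric_solutions_same_value[OF h(1,2) sol(3,6), of z] vals by simp
    qed
    ultimately show ?thesis
      using G.gap_sufficient psd_t \<open>?cond\<close> vals by (simp add: A\<^sub>t)
  qed
  show "?rep \<longleftrightarrow> ?atomic"
    using nec suf has_representing_measure_if_atomic by blast
  show "?rep \<longleftrightarrow> ?cond"
    using nec suf has_representing_measure_if_atomic by blast
  show "has_atomic_representing_measure (seq_rank (m + 1) \<beta>) (m + 3) \<beta> \<longleftrightarrow> L = R - D \<or> L = R + D" if ?rep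
  proof -
    from that obtain x y \<mu> where \<mu>: "representing_measure (2 * (m + 3)) (completion (m + 3) \<beta> x y) \<mu>"
      unfolding has_representing_measure_def by blast
    have solvable by (rule solvable_if_measure[OF \<mu>])
    interpret G: gapped_hankel m \<beta> a b c by (rule gap[OF \<open>solvable\<close>])
    show ?thesis
      using G.has_seq_rank_atoms_iff[OF \<mu>] gap_values[OF \<open>solvable\<close>] D_eq[OF \<open>solvable\<close>] by simp
  qed
qed

text \<open>Necessity combines two 2 x 2 minors, \<beta>_1^2 \<le> \<beta>_0 y and y^2 \<le>
  \<beta>_0 \<beta>_4, by eliminating y. Sufficiency uses explicit atoms.\<close>

lemma gap_moment_problem_2:
  fixes \<beta> :: "nat \<Rightarrow> real"
  assumes \<beta>0: "\<beta> 0 > 0"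
  shows "has_representing_measure 2 \<beta> \<Longrightarrow> (\<beta> 1)\<^sup>2 / \<beta> 0 \<le> sqrt (\<beta> 0 * \<beta> 4)"
    and "(\<beta> 1)\<^sup>2 / \<beta> 0 = sqrt (\<beta> 0 * \<beta> 4) \<Longrightarrow> has_atomic_representing_measure 1 2 \<beta>"
    and "(\<beta> 1)\<^sup>2 / \<beta> 0 < sqrt (\<beta> 0 * \<beta> 4) \<Longrightarrow> has_atomic_representing_measure 2 2 \<beta>"
proof -
  assume "has_representing_measure 2 \<beta>"
  then obtain x y \<mu> where \<mu>: "representing_measure (2 * 2) (completion 2 \<beta> x y) \<mu>"
    unfolding has_representing_measure_def by auto
  define \<gamma> where "\<gamma> = completion 2 \<beta> x y"
  have \<gamma>: "\<gamma> 0 = \<beta> 0" "\<gamma> (Suc 0) = \<beta> 1" "\<gamma> 2 = y" "\<gamma> (Suc (Suc 0)) = y" "\<gamma> 4 = \<beta> 4"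
    by (simp_all add: \<gamma>_def completion_def numeral_eq_Suc)
  have nonneg: "0 \<le> riesz \<gamma> (q * q)" if "degree q \<le> 2" for q
    using representing_measure_riesz_nonneg[OF \<mu> that] by (simp add: \<gamma>_def)
  have monom_form: "riesz \<gamma> ((monom e i + monom f j) * (monom e i + monom f j))
      = e * e * \<gamma> (i + i) + 2 * e * f * \<gamma> (i + j) + f * f * \<gamma> (j + j)" for e f i j
    by (simp add: distrib_left distrib_right mult_monom riesz_add add.commute[of j i])
  have deg: "degree (monom e i + monom f j :: real poly) \<le> 2" if "i \<le> 2" "j \<le> 2" for e f i j
    using that by (intro degree_add_le) (auto intro: order.trans[OF degree_monom_le])
  \<comment> \<open>The square of \<beta>_1 - \<beta>_0 t.\<close>
  have "0 \<le> \<beta> 1 * \<beta> 1 * \<beta> 0 + 2 * \<beta> 1 * (- \<beta> 0) * \<beta> 1 + (- \<beta> 0) * (- \<beta> 0) * y"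
    using nonneg[OF deg[of 0 1 "\<beta> 1" "- \<beta> 0"]] \<gamma> by (simp add: monom_form numeral_2_eq_2)
  then have "0 \<le> \<beta> 0 * (\<beta> 0 * y - \<beta> 1 * \<beta> 1)" by (simp add: algebra_simps)
  then have y1: "(\<beta> 1)\<^sup>2 / \<beta> 0 \<le> y"
    using \<beta>0 by (simp add: zero_le_mult_iff divide_le_eq power2_eq_square mult.commute)
  \<comment> \<open>The square of y - \<beta>_0 t^2.\<close>
  have "0 \<le> y * y * \<beta> 0 + 2 * y * (- \<beta> 0) * y + (- \<beta> 0) * (- \<beta> 0) * \<beta> 4"
    using nonneg[OF deg[of 0 2 "y" "- \<beta> 0"]] \<gamma> by (simp add: monom_form)
  then have "0 \<le> \<beta> 0 * (\<beta> 0 * \<beta> 4 - y * y)" by (simp add: algebra_simps)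
  then have "y\<^sup>2 \<le> \<beta> 0 * \<beta> 4"
    using \<beta>0 by (simp add: zero_le_mult_iff power2_eq_square)
  with y1 show "(\<beta> 1)\<^sup>2 / \<beta> 0 \<le> sqrt (\<beta> 0 * \<beta> 4)"
    using real_le_rsqrt by fastforce
next
  assume eq: "(\<beta> 1)\<^sup>2 / \<beta> 0 = sqrt (\<beta> 0 * \<beta> 4)"
  \<comment> \<open>A single atom of mass \<beta>_0 has to sit at the mean; the assumed equality
    makes its fourth moment correct.\<close>
  define t where "t = \<beta> 1 / \<beta> 0"
  have "0 \<le> sqrt (\<beta> 0 * \<beta> 4)" using \<beta>0 by (simp flip: eq)
  then have "((\<beta> 1)\<^sup>2 / \<beta> 0)\<^sup>2 = \<beta> 0 * \<beta> 4" unfolding eq by simp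
  then have t4: "\<beta> 4 = \<beta> 0 * t ^ 4"
    using \<beta>0 by (simp add: t_def power_divide field_simps power4_eq_xxxx power2_eq_square)
  have "has_atomic_representing_measure (card {t}) 2 \<beta>"
  proof (rule has_atomic_representing_measureI[where c = "\<lambda>_. \<beta> 0" and x = "\<beta> 0 * t ^ 3" and y = "\<beta> 0 * t ^ 2"])
    fix n :: nat assume "n \<le> 2 * 2"
    then consider "n = 0" | "n = 1" | "n = 2" | "n = 3" | "n = 4" by linarith
    then show "completion 2 \<beta> (\<beta> 0 * t ^ 3) (\<beta> 0 * t ^ 2) n = (\<Sum>t\<in>{t}. \<beta> 0 * t ^ n)"
      by cases (use t4 \<beta>0 in \<open>simp_all add: completion_def t_def\<close>)
  qed (use \<beta>0 in auto)
  then show "has_atomic_representing_measure 1 2 \<beta>" by simp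
next
  assume lt: "(\<beta> 1)\<^sup>2 / \<beta> 0 < sqrt (\<beta> 0 * \<beta> 4)"
  \<comment> \<open>Atoms at t and - t with t^4 = \<beta>_4 / \<beta>_0 give \<beta>_0 and \<beta>_4
    however the mass is split, and \<beta>_1 fixes the split. Both weights are positive iff
    \<bar>\<beta>_1\<bar> < \<beta>_0 t, which is the strict inequality.\<close>
  define q where "q = sqrt (\<beta> 0 * \<beta> 4) / \<beta> 0"
  define t where "t = sqrt q"
  have "0 \<le> (\<beta> 1)\<^sup>2 / \<beta> 0" using \<beta>0 by simp
  then have pos: "0 < sqrt (\<beta> 0 * \<beta> 4)" using lt by linarith
  then have q0: "0 < q" using \<beta>0 by (simp add: q_def)
  then have t0: "0 < t" and tt: "t * t = q" by (simp_all add: t_def)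
  have "\<beta> 0 * \<beta> 4 = (sqrt (\<beta> 0 * \<beta> 4))\<^sup>2" using pos by simp
  also have "\<dots> = (\<beta> 0 * q)\<^sup>2" using \<beta>0 by (simp add: q_def)
  finally have "\<beta> 4 = \<beta> 0 * (q * q)" using \<beta>0 by (simp add: power2_eq_square)
  then have t4: "\<beta> 4 = \<beta> 0 * t ^ 4" by (simp add: tt[symmetric] power4_eq_xxxx)
  have "(\<beta> 1)\<^sup>2 < \<beta> 0 * sqrt (\<beta> 0 * \<beta> 4)" using lt \<beta>0 by (simp add: divide_less_eq mult.commute)
  also have "\<dots> = \<beta> 0 * (\<beta> 0 * (t * t))" unfolding tt q_def using \<beta>0 by simp
  also have "\<dots> = (\<beta> 0 * t)\<^sup>2" by (simp add: power2_eq_square)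
  finally have "\<bar>\<beta> 1\<bar> < \<beta> 0 * t" using \<beta>0 t0 by (metis abs_le_square_iff abs_of_pos linorder_not_less mult_pos_pos)
  then have weights: "0 < \<beta> 0 + \<beta> 1 / t" "0 < \<beta> 0 - \<beta> 1 / t"
    using t0 by (simp_all add: field_simps abs_less_iff)
  define c where "c z = (if z = t then (\<beta> 0 + \<beta> 1 / t) / 2 else (\<beta> 0 - \<beta> 1 / t) / 2)" for z
  have "has_atomic_representing_measure (card {t, - t}) 2 \<beta>"
  proof (rule has_atomic_representing_measureI[where c = c and x = "\<beta> 1 * t ^ 2" and y = "\<beta> 0 * t ^ 2"])
    fix n :: nat assume "n \<le> 2 * 2"
    then consider "n = 0" | "n = 1" | "n = 2" | "n = 3" | "n = 4" by linarith
    then have "completion 2 \<beta> (\<beta> 1 * t ^ 2) (\<beta> 0 * t ^ 2) n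
        = (\<beta> 0 + \<beta> 1 / t) / 2 * t ^ n + (\<beta> 0 - \<beta> 1 / t) / 2 * (- t) ^ n"
      by cases (use t4 t0 in \<open>simp_all add: completion_def field_simps power2_eq_square power3_eq_cube power4_eq_xxxx\<close>)
    also have "\<dots> = (\<Sum>z\<in>{t, - t}. c z * z ^ n)"
      using t0 by (simp add: c_def)
    finally show "completion 2 \<beta> (\<beta> 1 * t ^ 2) (\<beta> 0 * t ^ 2) n = (\<Sum>z\<in>{t, - t}. c z * z ^ n)" .
  qed (use weights t0 in \<open>auto simp: c_def\<close>)
  moreover have "card {t, - t} = 2" using t0 by simp
  ultimately show "has_atomic_representing_measure 2 2 \<beta>" by (simp only:)
qed

theorem theorem3p5:
  fixes k :: nat and \<beta> :: "nat \<Rightarrow> real"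
    and A\<^sub>h A\<^sub>t B :: "real mat" and u s w :: "real vec" and L R D :: real
  assumes k: "k > 1"
    and \<beta>0: "\<beta> 0 > 0"
    (* A_h, A_t: Hankel matrices of (\<beta>_0, ..., \<beta>_(2k-6)) and (\<beta>_0, ..., \<beta>_(2k-4));
       B is A_h bordered by u and \<beta>_(2k). A_h, u, w, B, R, D are meaningless for k = 2 and only used for k > 2 *)
    and A\<^sub>h: "A\<^sub>h = hankel (k - 3) \<beta>"
    and A\<^sub>t: "A\<^sub>t = hankel (k - 2) \<beta>"
    and u: "u = vec (k - 2) (\<lambda>i. \<beta> (k + i))"
    and s: "s = vec (k - 1) (\<lambda>i. \<beta> (k - 1 + i))"
    and w: "w = vec (k - 2) (\<lambda>i. \<beta> (k - 2 + i))"
    and B: "B = four_block_mat A\<^sub>h (mat_of_row u)\<^sup>T (mat_of_row u) (mat 1 1 (\<lambda>_. \<beta> (2 * k)))"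
    and L: "L = s \<bullet> (pinv A\<^sub>t *\<^sub>v s)"
    and R: "R = u \<bullet> (pinv A\<^sub>h *\<^sub>v w)"
    and D: "D = sqrt (schur_complement A\<^sub>t (k - 2) $$ (0, 0) * schur_complement B (k - 2) $$ (0, 0))"
  shows
    "(has_representing_measure k \<beta> \<longleftrightarrow>
        has_atomic_representing_measure (seq_rank (k - 2) \<beta>) k \<beta> \<or>
        has_atomic_representing_measure (seq_rank (k - 2) \<beta> + 1) k \<beta>) \<and>
     (has_representing_measure k \<beta> \<longleftrightarrow>
        partially_psd (hankel k (partial_seq k \<beta>)) \<and>
        (k = 2 \<and> (\<beta> 1)\<^sup>2 / \<beta> 0 \<le> sqrt (\<beta> 0 * \<beta> 4) \<or>
         k > 2 \<and> L \<le> R + D \<and>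
           (pd_mat A\<^sub>t \<or>
            mat_rank A\<^sub>h = mat_rank A\<^sub>t \<and>
            mat_rank A\<^sub>t = mat_rank (mat_of_cols (k - 1) (cols A\<^sub>t @ [s])) \<and>
            mat_rank (mat_of_cols (k - 1) (cols A\<^sub>t @ [s])) = mat_rank B))) \<and>
     (has_representing_measure k \<beta> \<longrightarrow>
        (k = 2 \<longrightarrow>
           (if (\<beta> 1)\<^sup>2 / \<beta> 0 = sqrt (\<beta> 0 * \<beta> 4)
            then has_atomic_representing_measure 1 k \<beta>
            else has_atomic_representing_measure 2 k \<beta>)) \<and>
        (k > 2 \<longrightarrow>
           (has_atomic_representing_measure (seq_rank (k - 2) \<beta>) k \<beta> \<longleftrightarrow>
              L = R - D \<or> L = R + D)))"
proof (cases "k = 2")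
  case True
  \<comment> \<open>For k = 2 the sequence consisting of \<beta>_0 alone has rank 1, so the two
    admissible atom counts are 1 and 2.\<close>
  have "pd_mat (hankel 0 \<beta>)"
    unfolding pd_hankel_iff
  proof (intro allI impI)
    fix p :: "real poly" assume "degree p \<le> 0" "p \<noteq> 0"
    then obtain c where "p = [:c:]" "c \<noteq> 0" by (metis degree_eq_zeroE le_zero_eq pCons_0_0)
    then show "0 < riesz \<beta> (p * p)"
      using \<beta>0 by (auto simp: riesz_def zero_less_mult_iff linorder_neq_iff)
  qed
  then have rank: "seq_rank (k - 2) \<beta> = 1" using seq_rank_pd[of 0 \<beta>] True by simp
  have rep: "has_representing_measure k \<beta> \<longleftrightarrow> (\<beta> 1)\<^sup>2 / \<beta> 0 \<le> sqrt (\<beta> 0 * \<beta> 4)"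
    and atomic: "has_representing_measure k \<beta> \<Longrightarrow> (\<beta> 1)\<^sup>2 / \<beta> 0 \<noteq> sqrt (\<beta> 0 * \<beta> 4) \<Longrightarrow>
        has_atomic_representing_measure 2 k \<beta>"
    using gap_moment_problem_2[of \<beta>, OF \<beta>0] has_representing_measure_if_atomic unfolding True
    by (metis order_le_less)+
  have psd: "has_representing_measure k \<beta> \<Longrightarrow> partially_psd (hankel k (partial_seq k \<beta>))"
    unfolding has_representing_measure_def using representing_measure_partially_psd by blast
  have one: "(\<beta> 1)\<^sup>2 / \<beta> 0 = sqrt (\<beta> 0 * \<beta> 4) \<Longrightarrow> has_atomic_representing_measure 1 k \<beta>"
    using gap_moment_problem_2(2)[of \<beta>, OF \<beta>0] unfolding True .
  have "\<not> k > 2" "1 + 1 = (2 :: nat)" using True by simp_all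
  then show ?thesis
    using rep atomic psd one has_representing_measure_if_atomic True unfolding rank by metis
next
  case False
  define m where "m = k - 3"
  have m: "k = m + 3" using False k by (simp add: m_def)
  have idx: "k - 3 = m" "k - 2 = m + 1" "k - 1 = m + 2" "2 * k = 2 * m + 6"
    using m by simp_all
  have shift: "m + 1 + i = k - 2 + i" "m + 2 + i = k - 1 + i" "m + 3 + i = k + i" for i
    using m by simp_all
  note gap = gap_moment_problem[where m = m and \<beta> = \<beta> and A\<^sub>h = A\<^sub>h and A\<^sub>t = A\<^sub>t and B = B
      and u = u and s = s and w = w and L = L and R = R and D = D,
      unfolded shift, folded idx(1) idx(2) idx(3) idx(4), OF A\<^sub>h A\<^sub>t u s w B L R D]
  have "k > 2" using m by simp
  then show ?thesis using gap False unfolding m by auto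
qed

end
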